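(* Given a periodic billiard trajectory in the collared or transverse $\mathcal H$-ellipse, any billiard trajectory which shares the same caustic is also periodic with the same period.
   Context: $\mathbf M^3$ is $\mathbb R^3$ with coordinates $(x_0,x_1,x_2)$ and the form $\langle x,y\rangle=-x_0y_0+x_1y_1+x_2y_2$; $\mathcal H=\{x:\langle x,x\rangle=1\}$ with the restricted Lorentz metric. Geodesics of $\mathcal H$ are given by intersections of $\mathcal H$ with planes through the origin; they are space-, time- or light-like according to whether $\langle v,v\rangle>0,<0,=0$ for their tangent vectors $v$. Let $A=\mathrm{diag}(a_0,a_1,a_2)$. The cone $\langle A^{-1}x,x\rangle=-\frac{x_0^2}{a_0}+\frac{x_1^2}{a_1}+\frac{x_2^2}{a_2}=0$ cuts $\mathcal H$ in boundary curves. If $0<a_0<a_1<a_2$ they are two closed curves, the collared $\mathcal H$-ellipse, bounding the compact domain $\{x\in\mathcal H:\langle A^{-1}x,x\rangle\ge0\}$. If $a_1<0<a_0<a_2$ they form the transverse $\mathcal H$-ellipse; of the two compact domains one takes $\{x\in\mathcal H:\langle A^{-1}x,x\rangle\ge0,\ x_2>0\}$. Billiard: the particle moves along geodesics of $\mathcal H$ inside the domain (a space-like segment being the length-minimizing arc); on hitting the boundary at $p$ its velocity $v\in T_p\mathcal H$ is decomposed as $v=t+n$, with $t$ tangent and $n$ normal (with respect to $\langle\cdot,\cdot\rangle$) to the boundary curve within $\mathcal H$, and becomes $t-n$. At the four points of the transverse $\mathcal H$-ellipse with light-like tangent the reflection is counted twice. A trajectory is periodic with period $n$ if it closes up after $n$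 reflections. Caustic: the confocal conic $\mathcal C_\lambda$ is the intersection of $\mathcal H$ with the cone $-\frac{x_0^2}{a_0-\lambda}+\frac{x_1^2}{a_1-\lambda}+\frac{x_2^2}{a_2-\lambda}=0$ (degenerate for $\lambda\in\{a_0,a_1,a_2\}$). All segments of a given billiard trajectory are tangent (the planes through the origin containing them being tangent to the cone) to the same confocal conic, corresponding to $\lambda=\nu$; it is the caustic of the trajectory. Here $\nu$ is the root in $\mu$ of $\langle(A-\mu I)^{-1}x,y\rangle^2-\langle(A-\mu I)^{-1}x,x\rangle\langle(A-\mu I)^{-1}y,y\rangle=0$ for successive reflection points $x,y$; light-like trajectories have caustic at $\nu=\infty$. Two trajectories share the same caustic if they have the same $\nu$. *)

theory Defs
  imports "HOL-Analysis.Analysis"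
begin

(* The index type 3 is the integers modulo 3, so its elements may be written 0, 1, 2 (0 = 3);
   x $ 0 is the time-like coordinate. *)

definition mink :: "real ^ 3 \<Rightarrow> real ^ 3 \<Rightarrow> real" where
  "mink x y = - (x $ 0 * y $ 0) + x $ 1 * y $ 1 + x $ 2 * y $ 2"

definition hyperboloid :: "(real ^ 3) set" where
  "hyperboloid = {x. mink x x = 1}"

text \<open>A is the diagonal matrix with entries \<open>a $ 0, a $ 1, a $ 2\<close>;
  \<open>resolvent a \<mu> x\<close> is \<open>(A - \<mu> I)\<close> inverted, applied to \<open>x\<close>.
  It is meaningful only if \<open>\<mu>\<close> is none of the three entries.\<close>

definition resolvent :: "real ^ 3 \<Rightarrow> real \<Rightarrow> real ^ 3 \<Rightarrow> real ^ 3" where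
  "resolvent a \<mu> x = (\<chi> i. x $ i / (a $ i - \<mu>))"

definition confocal_form :: "real ^ 3 \<Rightarrow> real \<Rightarrow> real ^ 3 \<Rightarrow> real ^ 3 \<Rightarrow> real" where
  "confocal_form a \<mu> x y = mink (resolvent a \<mu> x) y"

definition confocal_cone :: "real ^ 3 \<Rightarrow> real \<Rightarrow> (real ^ 3) set" where
  "confocal_cone a \<mu> = {x. confocal_form a \<mu> x x = 0}"

subsection \<open>The billiard tables\<close>

definition collared :: "real ^ 3 \<Rightarrow> bool" where
  "collared a \<longleftrightarrow> 0 < a $ 0 \<and> a $ 0 < a $ 1 \<and> a $ 1 < a $ 2"

definition transverse :: "real ^ 3 \<Rightarrow> bool" where
  "transverse a \<longleftrightarrow> a $ 1 < 0 \<and> 0 < a $ 0 \<and> a $ 0 < a $ 2"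

definition collared_domain :: "real ^ 3 \<Rightarrow> (real ^ 3) set" where
  "collared_domain a = {x \<in> hyperboloid. confocal_form a 0 x x \<ge> 0}"

definition transverse_domain :: "real ^ 3 \<Rightarrow> (real ^ 3) set" where
  "transverse_domain a = {x \<in> hyperboloid. confocal_form a 0 x x \<ge> 0 \<and> x $ 2 > 0}"

definition is_table :: "real ^ 3 \<Rightarrow> (real ^ 3) set \<Rightarrow> bool" where
  "is_table a D \<longleftrightarrow>
     (collared a \<and> D = collared_domain a) \<or> (transverse a \<and> D = transverse_domain a)"

definition table_boundary :: "real ^ 3 \<Rightarrow> (real ^ 3) set \<Rightarrow> (real ^ 3) set" where
  "table_boundary a D = D \<inter> confocal_cone a 0"

subsection \<open>Geodesics\<close>

text \<open>Affinely parametrised geodesics with velocity \<open>\<gamma>'\<close>: the acceleration is normal to the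
  hyperboloid, i.e. its tangential part, the covariant derivative of \<open>\<gamma>'\<close>, vanishes.  The normal
  line at \<open>x\<close> is spanned by \<open>x\<close> itself.\<close>

definition geodesic_on ::
    "real set \<Rightarrow> (real \<Rightarrow> real ^ 3) \<Rightarrow> (real \<Rightarrow> real ^ 3) \<Rightarrow> bool" where
  "geodesic_on S \<gamma> \<gamma>' \<longleftrightarrow>
     (\<forall>t\<in>S. \<gamma> t \<in> hyperboloid \<and>
            (\<gamma> has_vector_derivative \<gamma>' t) (at t within S) \<and>
            (\<exists>c. (\<gamma>' has_vector_derivative c *\<^sub>R \<gamma> t) (at t within S)))"

text \<open>A segment leaves the boundary point \<open>x\<close> with velocity \<open>v\<close>, stays inside the table and
  arrives at its next boundary point \<open>y\<close> with velocity \<open>w\<close>.  A space-like geodesic is an ellipse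
  of total length \<open>2 * pi\<close>, so an arc of it is length-minimising iff its length is at most
  \<open>pi\<close>.\<close>

definition billiard_segment ::
    "real ^ 3 \<Rightarrow> (real ^ 3) set \<Rightarrow> real ^ 3 \<Rightarrow> real ^ 3 \<Rightarrow> real ^ 3 \<Rightarrow> real ^ 3 \<Rightarrow> bool" where
  "billiard_segment a D x v y w \<longleftrightarrow>
     x \<in> table_boundary a D \<and> y \<in> table_boundary a D \<and>
     (\<exists>T \<gamma> \<gamma>'. 0 < T \<and> geodesic_on {0..T} \<gamma> \<gamma>' \<and>
        \<gamma> 0 = x \<and> \<gamma>' 0 = v \<and> \<gamma> T = y \<and> \<gamma>' T = w \<and>
        (\<forall>t\<in>{0<..<T}. \<gamma> t \<in> D - table_boundary a D) \<and>
        (mink v v > 0 \<longrightarrow> T * sqrt (mink v v) \<le> pi))"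

subsection \<open>Reflection\<close>

definition tangent_space :: "real ^ 3 \<Rightarrow> (real ^ 3) set" where
  "tangent_space x = {v. mink x v = 0}"

text \<open>The kernel in the tangent space of the differential of \<open>confocal_form a 0 x x\<close>.\<close>

definition boundary_tangent :: "real ^ 3 \<Rightarrow> real ^ 3 \<Rightarrow> (real ^ 3) set" where
  "boundary_tangent a x = {t \<in> tangent_space x. confocal_form a 0 x t = 0}"

definition boundary_normal :: "real ^ 3 \<Rightarrow> real ^ 3 \<Rightarrow> (real ^ 3) set" where
  "boundary_normal a x = {n \<in> tangent_space x. \<forall>t\<in>boundary_tangent a x. mink n t = 0}"

definition lightlike_tangent :: "real ^ 3 \<Rightarrow> real ^ 3 \<Rightarrow> bool" where
  "lightlike_tangent a x \<longleftrightarrow> (\<exists>t\<in>boundary_tangent a x. t \<noteq> 0 \<and> mink t t = 0)"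

text \<open>Where the boundary has a light-like tangent, tangent and normal lines coincide and the
  decomposition is unavailable.  The first reflection there turns a trajectory into the tangent
  line, which meets the boundary at the same point only, and the second one sends it back along the
  incoming geodesic.  The pair of them reverses the velocity; it is treated as one event here
  and enters \<open>reflection_count\<close> with weight 2.\<close>

definition reflects :: "real ^ 3 \<Rightarrow> real ^ 3 \<Rightarrow> real ^ 3 \<Rightarrow> real ^ 3 \<Rightarrow> bool" where
  "reflects a x v v' \<longleftrightarrow>
     (if lightlike_tangent a x then v' = - v
      else \<exists>t n. t \<in> boundary_tangent a x \<and> n \<in> boundary_normal a x \<and> v = t + n \<and> v' = t - n)"

definition reflection_count :: "real ^ 3 \<Rightarrow> real ^ 3 \<Rightarrow> nat" where
  "reflection_count a x = (if lightlike_tangent a x then 2 else 1)"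

subsection \<open>Trajectories, periods and caustics\<close>

text \<open>\<open>p k\<close> is the point of the \<open>k\<close>-th impact and \<open>v k\<close> the velocity just after it.\<close>

definition billiard_trajectory ::
    "real ^ 3 \<Rightarrow> (real ^ 3) set \<Rightarrow> (nat \<Rightarrow> real ^ 3) \<Rightarrow> (nat \<Rightarrow> real ^ 3) \<Rightarrow> bool" where
  "billiard_trajectory a D p v \<longleftrightarrow>
     (\<forall>k. \<exists>w. billiard_segment a D (p k) (v k) (p (Suc k)) w \<and>
              reflects a (p (Suc k)) w (v (Suc k)))"

text \<open>The period \<open>n\<close> need not be the least one.\<close>

definition periodic_trajectory ::
    "real ^ 3 \<Rightarrow> nat \<Rightarrow> (nat \<Rightarrow> real ^ 3) \<Rightarrow> (nat \<Rightarrow> real ^ 3) \<Rightarrow> bool" where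
  "periodic_trajectory a n p v \<longleftrightarrow>
     (\<exists>m>0. (\<forall>k. p (k + m) = p k \<and> v (k + m) = v k) \<and>
            n = (\<Sum>k=1..m. reflection_count a (p k)))"

definition tangent_to_cone :: "real ^ 3 \<Rightarrow> real \<Rightarrow> (real ^ 3) set \<Rightarrow> bool" where
  "tangent_to_cone a \<mu> P \<longleftrightarrow>
     (\<exists>z\<in>confocal_cone a \<mu>. z \<noteq> 0 \<and> P = {y. confocal_form a \<mu> z y = 0})"

text \<open>For a plane spanned by \<open>x\<close> and \<open>y\<close>, for instance by two successive reflection points that are
  not collinear with the origin, tangency says that \<open>\<mu>\<close> is a root of the discriminant.\<close>

lemma tangent_to_cone_span_iff:
  assumes \<mu>: "\<mu> \<notin> {a $ 0, a $ 1, a $ 2}" and ind: "independent {x, y}" and "x \<noteq> y"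
  shows "tangent_to_cone a \<mu> (span {x, y}) \<longleftrightarrow>
    (confocal_form a \<mu> x y)\<^sup>2 - confocal_form a \<mu> x x * confocal_form a \<mu> y y = 0"
proof -
  let ?B = "confocal_form a \<mu>"
  define d :: "real ^ 3 \<Rightarrow> real ^ 3"
    where "d z = (\<chi> i. (if i = 0 then - 1 else 1) * z $ i / (a $ i - \<mu>))" for z
  have three: "(3::3) = 0" by simp
  have ne: "a $ i \<noteq> \<mu>" for i :: 3
    using \<mu> exhaust_3[of i] three by auto
  have Bd: "?B z u = d z \<bullet> u" for z u
    by (simp add: confocal_form_def mink_def resolvent_def d_def inner_vec_def sum_3 three)
  have d0: "d z \<noteq> 0" if "z \<noteq> 0" for z
  proof
    assume "d z = 0"
    hence dz: "d z $ i = 0" for i by simp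
    have "z $ i = 0" for i
      using dz[of i] ne[of i] by (cases "i = 0") (simp_all add: d_def)
    with that show False by (simp add: vec_eq_iff)
  qed
  have sym: "?B u z = ?B z u" for u z
    by (simp add: confocal_form_def mink_def resolvent_def algebra_simps)
  have lin: "?B (\<alpha> *\<^sub>R x + \<beta> *\<^sub>R y) u = \<alpha> * ?B x u + \<beta> * ?B y u" for \<alpha> \<beta> u
    unfolding sym[of _ u] by (simp add: Bd inner_add_right)
  have mem: "u \<in> span {x, y} \<longleftrightarrow> (\<exists>\<alpha> \<beta>. u = \<alpha> *\<^sub>R x + \<beta> *\<^sub>R y)" for u
    by (auto simp: span_insert span_singleton diff_eq_eq add.commute)
  have nz: "\<alpha> = 0 \<and> \<beta> = 0" if e: "\<alpha> *\<^sub>R x + \<beta> *\<^sub>R y = 0" for \<alpha> \<beta>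
  proof -
    have "(\<Sum>v\<in>{x, y}. (if v = x then \<alpha> else \<beta>) *\<^sub>R v) = 0" using e \<open>x \<noteq> y\<close> by auto
    hence "\<forall>v\<in>{x, y}. (if v = x then \<alpha> else \<beta>) = 0"
      using independentD[OF ind, of "{x, y}" "\<lambda>v. if v = x then \<alpha> else \<beta>"] by blast
    with \<open>x \<noteq> y\<close> show ?thesis by (auto split: if_splits)
  qed
  show ?thesis
  proof
    assume "tangent_to_cone a \<mu> (span {x, y})"
    then obtain z where z: "?B z z = 0" "z \<noteq> 0" "span {x, y} = {u. ?B z u = 0}"
      unfolding tangent_to_cone_def confocal_cone_def by blast
    from z(1,3) have "z \<in> span {x, y}" by simp
    then obtain \<alpha> \<beta> where zab: "z = \<alpha> *\<^sub>R x + \<beta> *\<^sub>R y" using mem by blast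
    have "x \<in> span {x, y}" "y \<in> span {x, y}" by (simp_all add: span_base)
    hence "?B z x = 0" "?B z y = 0" unfolding z(3) by simp_all
    hence e: "\<alpha> * ?B x x + \<beta> * ?B x y = 0" "\<alpha> * ?B x y + \<beta> * ?B y y = 0"
      unfolding zab lin by (simp_all add: sym[of y x])
    have "\<alpha> * ((?B x y)\<^sup>2 - ?B x x * ?B y y) = 0" "\<beta> * ((?B x y)\<^sup>2 - ?B x x * ?B y y) = 0"
      using e by algebra+
    moreover have "\<alpha> \<noteq> 0 \<or> \<beta> \<noteq> 0" using z(2) zab by auto
    ultimately show "(?B x y)\<^sup>2 - ?B x x * ?B y y = 0" by auto
  next
    assume disc: "(?B x y)\<^sup>2 - ?B x x * ?B y y = 0"
    obtain \<alpha> \<beta> where ab: "\<alpha> \<noteq> 0 \<or> \<beta> \<noteq> 0"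
      "\<alpha> * ?B x x + \<beta> * ?B x y = 0" "\<alpha> * ?B x y + \<beta> * ?B y y = 0"
    proof (cases "?B x x = 0")
      case True
      with disc show ?thesis by (intro that[of 1 0]) auto
    next
      case False
      with disc show ?thesis
        by (intro that[of "?B x y" "- ?B x x"]) (auto simp: power2_eq_square)
    qed
    define z where "z = \<alpha> *\<^sub>R x + \<beta> *\<^sub>R y"
    have z0: "z \<noteq> 0" using nz[of \<alpha> \<beta>] ab(1) by (auto simp: z_def)
    have zx: "?B z x = 0" "?B z y = 0"
      using ab(2,3) unfolding z_def lin by (simp_all add: sym[of y x])
    have sub: "span {x, y} \<subseteq> {u. d z \<bullet> u = 0}"
      using zx by (auto simp: mem Bd inner_add_right)
    have "dim {u. d z \<bullet> u = 0} = 2" using dim_hyperplane[OF d0[OF z0]] by simp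
    moreover have "dim (span {x, y}) = 2"
      using \<open>x \<noteq> y\<close> by (simp add: dim_span dim_eq_card_independent[OF ind])
    ultimately have eq: "span {x, y} = {u. d z \<bullet> u = 0}"
      by (intro subspace_dim_equal[OF _ _ sub]) (auto simp: subspace_hyperplane)
    have "z \<in> span {x, y}" using mem z_def by blast
    hence "z \<in> confocal_cone a \<mu>" using eq by (simp add: confocal_cone_def Bd)
    with z0 eq show "tangent_to_cone a \<mu> (span {x, y})"
      unfolding tangent_to_cone_def Bd by blast
  qed
qed

text \<open>The plane of the segment leaving \<open>p k\<close> is spanned by \<open>p k\<close> and \<open>v k\<close>.  The cones with
  \<open>\<mu>\<close> an entry of \<open>a\<close> are degenerate and do not count as caustics.\<close>

definition has_caustic ::
    "real ^ 3 \<Rightarrow> (nat \<Rightarrow> real ^ 3) \<Rightarrow> (nat \<Rightarrow> real ^ 3) \<Rightarrow> ereal \<Rightarrow> bool" where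
  "has_caustic a p v \<nu> \<longleftrightarrow>
     (\<exists>\<mu>. \<nu> = ereal \<mu> \<and> \<mu> \<notin> {a $ 0, a $ 1, a $ 2} \<and>
          (\<forall>k. tangent_to_cone a \<mu> (span {p k, v k}))) \<or>
     (\<nu> = \<infinity> \<and> (\<forall>k. mink (v k) (v k) = 0))"

definition same_caustic ::
    "real ^ 3 \<Rightarrow> (nat \<Rightarrow> real ^ 3) \<Rightarrow> (nat \<Rightarrow> real ^ 3) \<Rightarrow>
     (nat \<Rightarrow> real ^ 3) \<Rightarrow> (nat \<Rightarrow> real ^ 3) \<Rightarrow> bool" where
  "same_caustic a p v q w \<longleftrightarrow> (\<exists>\<nu>. has_caustic a p v \<nu> \<and> has_caustic a q w \<nu>)"

end

theory Submission
  imports Defs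
begin

text \<open>
  The statement is a real form of Poncelet's closure theorem. A segment that leaves \<open>x\<close> with
  velocity \<open>v\<close> is recorded as a flag \<open>(x, \<xi>)\<close>, a point of the projective plane on a line, where the
  line is given by the cross product \<open>\<xi>\<close> of \<open>x\<close> and \<open>v\<close>. The boundary is a conic \<open>\<Sum> c\<^sub>i x\<^sub>i\<^sup>2 = 0\<close>,
  and the lines tangent to a confocal conic form a dual conic \<open>\<Sum> b\<^sub>i \<xi>\<^sub>i\<^sup>2 = 0\<close>; confocality makes
  both diagonal in the same coordinates. The flags of the two conics form a curve of genus one.
  Travelling along a segment keeps \<open>\<xi>\<close> and exchanges the two points of the boundary on it; a
  reflection keeps \<open>x\<close> and exchanges the two tangents to the caustic through it. Both exchanges have
  the form \<open>u \<mapsto> const - u\<close> in the group law of the curve, so the billiard map is a translation, and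
  an iterate of a translation that fixes one point is the identity.

  The group law itself can be avoided. A flag carries two numbers \<open>y\<close> and \<open>\<eta>\<close>, the
  \<open>cross_eigenvalue\<close>s, with \<open>x \<times> (b \<xi>) = y \<xi>\<close> and \<open>\<xi> \<times> (c x) = \<eta> x\<close>, and the two exchanges reverse
  the signs of \<open>\<eta>\<close> and of \<open>y\<close>. For two flags there are three ratios
  \<open>(y x'\<^sub>i - x\<^sub>i y') : (x\<^sub>j x'\<^sub>k + x\<^sub>k x'\<^sub>j)\<close>, odd functions of the difference of the flags in the
  group law. Up to constants they are the same whether they are computed from \<open>(x, y)\<close> or from
  \<open>(\<xi>, \<eta>)\<close> (\<open>offset_dual\<close>), so each of the exchanges, applied to both flags, only changes their
  sign, and the two together preserve them. One flag and the ratios determine the other flag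
  (\<open>offset_unique\<close>). Hence, if one chain closes after \<open>n\<close> steps, so does every other
  (\<open>poncelet_porism\<close>).

  For the billiard, \<open>-\<eta>\<close> is Joachimsthal's quantity \<open>\<langle>A\<inverse> x, v\<rangle>\<close>. It changes sign along a segment,
  because its square depends on \<open>\<xi>\<close> only and the segment enters and leaves the table; the reflection
  changes it back and therefore reverses \<open>y\<close>, because the product \<open>y \<eta>\<close> depends only on the
  component of the velocity tangent to the boundary. At a point with light-like boundary tangent the
  reversal of the velocity amounts to two Poncelet steps, with the tangent line as the intermediate
  line (\<open>poncelet_event\<close>); this is why such a reflection counts twice.

  Poncelet's theorem closes a trajectory only projectively. The scale of the velocity is then fixed
  by the conservation of \<open>\<langle>A\<inverse> x, v\<rangle>\<close> (\<open>trajectory_returns\<close>). The sign of the point is fixed by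
  \<open>x\<^sub>2 > 0\<close> in the transverse case; in the collared case every segment changes the sign of \<open>x\<^sub>0\<close>
  (\<open>collared_alternates\<close>), so the period is even and the sign returns as well. The caustic \<open>\<nu> = 0\<close>
  is the boundary itself; its trajectories exist only in the collared table and oscillate between
  two antipodal points (\<open>tangential_trajectory\<close>).
\<close>

section \<open>Cyclic coordinates\<close>

text \<open>
  The index type is \<open>\<int>/3\<close>, so \<open>i\<close>, \<open>i + 1\<close>, \<open>i + 2\<close> run cyclically through all coordinates, and an
  identity that is invariant under cyclic permutations needs to be checked for one \<open>i\<close> only.
\<close>

lemma index_simps [simp]:
  "(i::3) + 1 + 1 = i + 2" "i + 1 + 2 = i" "i + 2 + 1 = i" "i + 2 + 2 = i + 1"
  using exhaust_3[of i] by auto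

lemma index_neq [simp]: "(i::3) \<noteq> i + 1" "i \<noteq> i + 2" "i + 1 \<noteq> i + 2" "i + 1 \<noteq> i" "i + 2 \<noteq> i"
    "i + 2 \<noteq> i + 1"
  using exhaust_3[of i] by auto

lemma index_wrap: "(3::3) = 0" "(4::3) = 1"
  by simp_all

lemma index_cases: "(j::3) = i \<or> j = i + 1 \<or> j = i + 2"
  using exhaust_3[of i] exhaust_3[of j] by auto

lemma index_012: "(i::3) = 0 \<or> i = 1 \<or> i = 2"
  using index_cases[of i 0] by simp

lemma sum_cyclic: "sum f (UNIV :: 3 set) = f i + f (i + 1) + f (i + 2)" for f :: "3 \<Rightarrow> real"
  using exhaust_3[of i] by (auto simp: sum_3 index_wrap)

lemma inner_cyclic: "u \<bullet> v = u $ i * v $ i + u $ (i + 1) * v $ (i + 1) + u $ (i + 2) * v $ (i + 2)"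
  for u v :: "real ^ 3"
  by (simp add: inner_vec_def sum_cyclic[of _ i])

lemma cross3_nth: "cross3 u v $ i = u $ (i + 1) * v $ (i + 2) - u $ (i + 2) * v $ (i + 1)"
  using exhaust_3[of i] by (elim disjE) (simp_all add: cross3_def vector_def index_wrap)

section \<open>Flags of a conic and a dual conic\<close>

definition flag :: "real ^ 3 \<Rightarrow> real ^ 3 \<Rightarrow> real ^ 3 \<Rightarrow> real ^ 3 \<Rightarrow> bool" where
  "flag b c x \<xi> \<longleftrightarrow> x \<noteq> 0 \<and> \<xi> \<noteq> 0 \<and> x \<bullet> (c * x) = 0 \<and> \<xi> \<bullet> (b * \<xi>) = 0 \<and> x \<bullet> \<xi> = 0"

text \<open>
  The linear map \<open>\<zeta> \<mapsto> x \<times> (b \<zeta>)\<close> sends the plane orthogonal to \<open>x\<close> to itself, has trace zero there,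
  and every \<open>b\<close>-isotropic vector of this plane is an eigenvector. On a flag this number is the
  eigenvalue that belongs to \<open>\<xi>\<close>, and because of the trace its sign tells apart the two tangents
  through \<open>x\<close>.
\<close>

definition cross_eigenvalue :: "real ^ 3 \<Rightarrow> real ^ 3 \<Rightarrow> real ^ 3 \<Rightarrow> real" where
  "cross_eigenvalue b x \<xi> = (cross3 x (b * \<xi>) \<bullet> \<xi>) / (\<xi> \<bullet> \<xi>)"

text \<open>
  The second condition says that the conic and the dual conic, brought to the same space of conics
  by inversion of \<open>b\<close>, span a pencil with three different degenerate members; it makes the curve of
  flags smooth.
\<close>

definition regular_pair :: "real ^ 3 \<Rightarrow> real ^ 3 \<Rightarrow> bool" where
  "regular_pair b c \<longleftrightarrow> (\<forall>i. b $ i \<noteq> 0 \<and> c $ i \<noteq> 0) \<and> inj (\<lambda>i. b $ i * c $ i)"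

lemma flag_swap: "flag b c x \<xi> \<longleftrightarrow> flag c b \<xi> x"
  by (auto simp: flag_def inner_commute)

lemma regular_pair_swap: "regular_pair b c \<longleftrightarrow> regular_pair c b"
  by (auto simp: regular_pair_def mult.commute)

lemma parallel_if_cross_zero:
  assumes "cross3 \<xi> u = 0" "\<xi> \<noteq> 0"
  shows "u = ((u \<bullet> \<xi>) / (\<xi> \<bullet> \<xi>)) *\<^sub>R \<xi>"
proof -
  have "(\<xi> \<bullet> u) *\<^sub>R \<xi> = (\<xi> \<bullet> \<xi>) *\<^sub>R u"
    using Cross3.Lagrange[of \<xi> \<xi> u] assms(1) by simp
  hence "(1 / (\<xi> \<bullet> \<xi>)) *\<^sub>R ((\<xi> \<bullet> u) *\<^sub>R \<xi>) = (1 / (\<xi> \<bullet> \<xi>)) *\<^sub>R ((\<xi> \<bullet> \<xi>) *\<^sub>R u)" by simp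
  thus ?thesis using assms(2) by (simp add: inner_commute)
qed

text \<open>
  Both vectors are orthogonal to \<open>x\<close> and to \<open>b \<xi>\<close>.
\<close>

lemma cross_eigenvector:
  assumes "flag b c x \<xi>"
  shows "cross3 x (b * \<xi>) = cross_eigenvalue b x \<xi> *\<^sub>R \<xi>"
proof -
  have "cross3 \<xi> (cross3 x (b * \<xi>)) = 0"
    using assms by (simp add: Cross3.Lagrange flag_def inner_commute)
  from parallel_if_cross_zero[OF this] assms show ?thesis
    by (simp add: cross_eigenvalue_def flag_def)
qed

lemma cross_eigenvector_nth:
  assumes "flag b c x \<xi>"
  shows "x $ (i + 1) * b $ (i + 2) * \<xi> $ (i + 2) - x $ (i + 2) * b $ (i + 1) * \<xi> $ (i + 1)
      = cross_eigenvalue b x \<xi> * \<xi> $ i"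
  using arg_cong[OF cross_eigenvector[OF assms], of "\<lambda>u. u $ i"]
      by (simp add: cross3_nth mult.assoc)

lemma cross_eigenvalue_eqI:
  assumes "cross3 x (b * \<xi>) = y *\<^sub>R \<xi>" "\<xi> \<noteq> 0"
  shows "cross_eigenvalue b x \<xi> = y"
  using assms by (simp add: cross_eigenvalue_def)

text \<open>
  The equation of the curve of flags as a double cover of the conic, the square root of the
  discriminant being \<open>y\<close>.
\<close>

definition on_cover :: "real ^ 3 \<Rightarrow> real ^ 3 \<Rightarrow> real ^ 3 \<Rightarrow> real \<Rightarrow> bool" where
  "on_cover b c x y \<longleftrightarrow> x \<noteq> 0 \<and> x \<bullet> (c * x) = 0 \<and>
     y\<^sup>2 + (\<Sum>i\<in>UNIV. b $ (i + 1) * b $ (i + 2) * (x $ i)\<^sup>2) = 0"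

text \<open>
  On the plane orthogonal to \<open>x\<close> the map \<open>\<zeta> \<mapsto> x \<times> (b \<zeta>)\<close> has trace zero and the sum as its
  determinant, so by Cayley-Hamilton its square is minus the sum times the identity.
\<close>

lemma on_cover_flag:
  assumes "flag b c x \<xi>"
  shows "on_cover b c x (cross_eigenvalue b x \<xi>)"
proof -
  from assms have "\<xi> \<noteq> 0" by (simp add: flag_def)
  then obtain i where i: "\<xi> $ i \<noteq> 0" by (auto simp: vec_eq_iff)
  let ?y = "cross_eigenvalue b x \<xi>"
  note r0 = cross_eigenvector_nth[OF assms, of i]
      and r1 = cross_eigenvector_nth[OF assms, of "i+1", simplified]
    and r2 = cross_eigenvector_nth[OF assms, of "i+2", simplified]
  have o: "x $ i * \<xi> $ i + x $ (i + 1) * \<xi> $ (i + 1) + x $ (i + 2) * \<xi> $ (i + 2) = 0"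
    using assms by (simp add: flag_def inner_cyclic[of _ _ i])
  have "\<xi> $ i * (?y\<^sup>2 + (b $ (i + 1) * b $ (i + 2) * (x $ i)\<^sup>2 + b $ (i + 2)
      * b $ i * (x $ (i + 1))\<^sup>2
      + b $ i * b $ (i + 1) * (x $ (i + 2))\<^sup>2)) = 0"
    using r0 r1 r2 o by algebra
  hence "?y\<^sup>2 + (\<Sum>i\<in>UNIV. b $ (i + 1) * b $ (i + 2) * (x $ i)\<^sup>2) = 0"
    using i by (simp add: sum_cyclic[of _ i])
  thus ?thesis using assms by (simp add: on_cover_def flag_def)
qed

section \<open>The difference of two flags\<close>

text \<open>
  For each index two ratios, of the terms multiplied by \<open>\<sigma> i\<close> to those multiplied by \<open>\<rho> i\<close>, are
  required to equal \<open>\<rho> i : \<sigma> i\<close>. The constants in the second ratio are chosen such that the two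
  agree on the curve; one of them is meaningful where the other is \<open>0 : 0\<close>. Each is an odd function
  of the difference of the two points of the curve, because the zeros and poles that depend on their
  sum cancel. The values are kept as pairs because \<open>\<sigma> i\<close> vanishes where they are infinite.
\<close>

definition offset :: "real ^ 3 \<Rightarrow> real ^ 3 \<Rightarrow> (3 \<Rightarrow> real) \<Rightarrow> (3 \<Rightarrow> real) \<Rightarrow> real ^ 3 \<Rightarrow> real \<Rightarrow> real ^ 3 \<Rightarrow>
    real \<Rightarrow> bool"
  where "offset b c \<rho> \<sigma> x y x' y' \<longleftrightarrow> (\<forall>i.
     \<sigma> i * (y * x' $ i - x $ i * y') = \<rho> i * (x $ (i + 1) * x' $ (i + 2) + x $ (i + 2)
         * x' $ (i + 1)) \<and>
     \<sigma> i * (b $ i * (b $ (i + 2) * c $ (i + 2) - b $ (i + 1) * c $ (i + 1)) *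
         (x $ (i + 1) * x' $ (i + 2) - x $ (i + 2) * x' $ (i + 1)))
       = \<rho> i * (c $ i * (y * x' $ i + x $ i * y')))"

lemma offset_minus: "offset b c \<rho> \<sigma> x y x' y' \<Longrightarrow> offset b c (\<lambda>i. - \<rho> i) \<sigma> x (- y) x' (- y')"
  unfolding offset_def by (simp add: algebra_simps)

lemma on_cover_cyclic:
  assumes "on_cover b c x y"
  shows "c $ i * (x $ i)\<^sup>2 + c $ (i + 1) * (x $ (i + 1))\<^sup>2 + c $ (i + 2) * (x $ (i + 2))\<^sup>2 = 0"
    "y\<^sup>2 + b $ (i + 1) * b $ (i + 2) * (x $ i)\<^sup>2 + b $ (i + 2) * b $ i * (x $ (i + 1))\<^sup>2
      + b $ i * b $ (i + 1) * (x $ (i + 2))\<^sup>2 = 0"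
  using assms by (simp_all add: on_cover_def inner_cyclic[of _ _ i] sum_cyclic[of _ i]
      power2_eq_square mult_ac)

lemma regular_pairD:
  assumes "regular_pair b c"
  shows "b $ i \<noteq> 0" "c $ i \<noteq> 0" "i \<noteq> j \<Longrightarrow> b $ i * c $ i - b $ j * c $ j \<noteq> 0"
  using assms by (auto simp: regular_pair_def inj_def)

text \<open>
  Two vanishing coordinates would leave two linear equations for the squares of the other two
  coordinates, with a determinant that is a product of numbers which regularity makes nonzero.
\<close>

lemma on_cover_at_most_one_zero:
  assumes reg: "regular_pair b c" and xy: "on_cover b c x y"
  shows "x $ i = 0 \<Longrightarrow> y \<noteq> 0" "x $ i = 0 \<Longrightarrow> i \<noteq> j \<Longrightarrow> x $ j \<noteq> 0"
proof -
  note q = on_cover_cyclic[OF xy]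
  have nz: "x $ i \<noteq> 0 \<or> x $ (i+1) \<noteq> 0 \<or> x $ (i+2) \<noteq> 0" for i
    using xy index_cases[of _ i] by (auto simp: on_cover_def vec_eq_iff) metis
  note d = regular_pairD[OF reg]
  show "y \<noteq> 0" if "x $ i = 0"
  proof
    assume "y = 0"
    with q[of i] that have e: "c $ (i + 1) * (x $ (i + 1))\<^sup>2 + c $ (i + 2) * (x $ (i + 2))\<^sup>2 = 0"
      "b $ i * (b $ (i + 2) * (x $ (i + 1))\<^sup>2 + b $ (i + 1) * (x $ (i + 2))\<^sup>2) = 0"
      by (simp_all add: algebra_simps)
    from e(2) d(1)[of i] have e2: "b $ (i + 2) * (x $ (i + 1))\<^sup>2 + b $ (i + 1) * (x $ (i + 2))\<^sup>2
        = 0" by simp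
    have "(b $ (i + 1) * c $ (i+1) - b $ (i+2) * c $ (i + 2)) * (x $ (i + 1))\<^sup>2 = 0"
      "(b $ (i + 1) * c $ (i+1) - b $ (i+2) * c $ (i + 2)) * (x $ (i + 2))\<^sup>2 = 0"
      using e(1) e2 by algebra+
    with d(3)[of "i+1" "i+2"] nz[of i] that show False by simp
  qed
  show "x $ j \<noteq> 0" if "x $ i = 0" "i \<noteq> j"
  proof
    assume "x $ j = 0"
    have "j = i + 1 \<or> j = i + 2" using that(2) index_cases[of j i] by auto
    thus False using q(1)[of i] that(1) \<open>x $ j = 0\<close> nz[of i] d(2)[of "i+1"] d(2)[of "i+2"] by auto
  qed
qed

text \<open>
  If all four terms vanished, then so would the products \<open>y x'\<^sub>i\<close>, \<open>x\<^sub>i y'\<close>, \<open>x\<^sub>j x'\<^sub>k\<close> and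
  \<open>x\<^sub>k x'\<^sub>j\<close>. This takes four vanishing coordinates among the two points, but each point has at most
  one.
\<close>

lemma offset_nonzero:
  assumes reg: "regular_pair b c" and P: "on_cover b c x y" and Q: "on_cover b c x' y'"
  shows "y * x' $ i - x $ i * y' \<noteq> 0 \<or> x $ (i + 1) * x' $ (i + 2) + x $ (i + 2) * x' $ (i + 1) \<noteq> 0 \<or>
    b $ i * (b $ (i + 2) * c $ (i + 2) - b $ (i + 1) * c $ (i + 1)) * (x $ (i + 1)
        * x' $ (i + 2) - x $ (i + 2) * x' $ (i + 1)) \<noteq> 0
    \<or> c $ i * (y * x' $ i + x $ i * y') \<noteq> 0"
proof (rule ccontr)
  assume "\<not> ?thesis"
  hence z: "y * x' $ i - x $ i * y' = 0" "x $ (i + 1) * x' $ (i + 2) + x $ (i + 2)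
      * x' $ (i + 1) = 0"
    "b $ i * (b $ (i + 2) * c $ (i + 2) - b $ (i + 1) * c $ (i + 1)) * (x $ (i + 1)
        * x' $ (i + 2) - x $ (i + 2) * x' $ (i + 1)) = 0"
    "c $ i * (y * x' $ i + x $ i * y') = 0" by blast+
  note d = regular_pairD[OF reg]
  have "y * x' $ i + x $ i * y' = 0" using z(4) d(2)[of i] by simp
  with z(1) have 1: "y * x' $ i = 0" "x $ i * y' = 0" by auto
  have "x $ (i + 1) * x' $ (i + 2) - x $ (i + 2) * x' $ (i + 1) = 0"
    using z(3) d(1)[of i] d(3)[of "i+2" "i+1"] by simp
  with z(2) have 2: "x $ (i + 1) * x' $ (i + 2) = 0" "x $ (i + 2) * x' $ (i + 1) = 0" by auto
  note P1 = on_cover_at_most_one_zero[OF reg P] and Q1 = on_cover_at_most_one_zero[OF reg Q]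
  have "y = 0 \<or> x' $ i = 0" "x $ i = 0 \<or> y' = 0" "x $ (i + 1) = 0 \<or> x' $ (i + 2) = 0"
    "x $ (i + 2) = 0 \<or> x' $ (i + 1) = 0" using 1 2 by simp_all
  moreover note P1(1)[of i] P1(1)[of "i+1"] P1(1)[of "i+2"] P1(2)[of "i+1" "i+2"] P1(2)[of "i"
      "i+2"] P1(2)[of "i" "i+1"]
    Q1(1)[of i] Q1(1)[of "i+1"] Q1(1)[of "i+2"] Q1(2)[of "i+1" "i+2"] Q1(2)[of "i"
        "i+2"] Q1(2)[of "i" "i+1"]
  ultimately show False using index_neq by blast
qed

text \<open>
  The two ratios agree on the curve, by the elimination of \<open>y\<^sup>2\<close> and \<open>x\<^sub>i\<^sup>2\<close>, and at most one of
  them is \<open>0 : 0\<close>.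
\<close>

lemma offset_exists:
  assumes reg: "regular_pair b c" and P: "on_cover b c x y" and Q: "on_cover b c x' y'"
  shows "\<exists>\<rho> \<sigma>. (\<forall>i. \<rho> i \<noteq> 0 \<or> \<sigma> i \<noteq> 0) \<and> offset b c \<rho> \<sigma> x y x' y'"
proof -
  define A where "A i = y * x' $ i - x $ i * y'" for i
  define B where "B i = x $ (i + 1) * x' $ (i + 2) + x $ (i + 2) * x' $ (i + 1)" for i
  define C where "C i = b $ i * (b $ (i + 2) * c $ (i + 2) - b $ (i + 1) * c $ (i + 1)) *
         (x $ (i + 1) * x' $ (i + 2) - x $ (i + 2) * x' $ (i + 1))" for i
  define E where "E i = c $ i * (y * x' $ i + x $ i * y')" for i
  have AE: "A i * E i = B i * C i" for i
  proof -
    note p = on_cover_cyclic[OF P, of i] and q = on_cover_cyclic[OF Q, of i]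
    have "c $ i * (A i * E i - B i * C i) = 0"
      unfolding A_def B_def C_def E_def using p q by algebra
    thus ?thesis using regular_pairD(2)[OF reg, of i] by simp
  qed
  have nz: "A i \<noteq> 0 \<or> B i \<noteq> 0 \<or> C i \<noteq> 0 \<or> E i \<noteq> 0" for i
    unfolding A_def B_def C_def E_def by (rule offset_nonzero[OF assms])
  \<comment> \<open>the first ratio, or the second one where the first is \<open>0 : 0\<close>\<close>
  define \<rho> where "\<rho> i = (if A i = 0 \<and> B i = 0 then C i else A i)" for i
  define \<sigma> where "\<sigma> i = (if A i = 0 \<and> B i = 0 then E i else B i)" for i
  have "offset b c \<rho> \<sigma> x y x' y'"
    unfolding offset_def A_def[symmetric] B_def[symmetric] C_def[symmetric] E_def[symmetric]
    using AE by (auto simp: \<rho>_def \<sigma>_def mult.commute)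
  moreover have "\<rho> i \<noteq> 0 \<or> \<sigma> i \<noteq> 0" for i using nz[of i] by (auto simp: \<rho>_def \<sigma>_def)
  ultimately show ?thesis by blast
qed

text \<open>
  Multiplying one eigenvector equation by the other eigenvalue and inserting the other equation
  gives the claim times any chosen coordinate of \<open>x\<close>; a nonzero one can be cancelled.
\<close>

lemma cross_eigenvalue_mult:
  assumes F: "flag b c x \<xi>"
  shows "cross_eigenvalue b x \<xi> * cross_eigenvalue c \<xi> x
      = - (b $ i * c $ i * (x $ i * \<xi> $ i) + b $ (i + 1) * c $ (i + 1) * (x $ (i + 1) * \<xi> $ (i + 1))
     + b $ (i + 2) * c $ (i + 2) * (x $ (i + 2) * \<xi> $ (i + 2)))"
proof -
  let ?y = "cross_eigenvalue b x \<xi>" and ?\<eta> = "cross_eigenvalue c \<xi> x"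
  have *: "?y * ?\<eta> = - (b $ i * c $ i * (x $ i * \<xi> $ i) + b $ (i + 1) * c $ (i + 1)
      * (x $ (i + 1) * \<xi> $ (i + 1))
     + b $ (i + 2) * c $ (i + 2) * (x $ (i + 2) * \<xi> $ (i + 2)))" if "x $ i \<noteq> 0" for i
  proof -
    have F': "flag c b \<xi> x" using F by (simp add: flag_swap)
    note r = cross_eigenvector_nth[OF F, of "i+1", simplified]
        cross_eigenvector_nth[OF F, of "i+2", simplified] cross_eigenvector_nth[OF F', of i]
    note q = on_cover_cyclic(1)[OF on_cover_flag[OF F], of i]
    have "x $ i * (?y * ?\<eta> + (b $ i * c $ i * (x $ i * \<xi> $ i) + b $ (i + 1) * c $ (i + 1)
        * (x $ (i + 1) * \<xi> $ (i + 1))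
     + b $ (i + 2) * c $ (i + 2) * (x $ (i + 2) * \<xi> $ (i + 2)))) = 0"
      using r q by algebra
    with that show ?thesis by simp
  qed
  from F have "x \<noteq> 0" by (simp add: flag_def)
  then obtain j where j: "x $ j \<noteq> 0" by (auto simp: vec_eq_iff)
  show ?thesis using *[OF j] index_cases[of j i] by auto
qed

text \<open>
  Expanding the left-hand side gives only the products \<open>y \<eta>\<close>, \<open>y \<xi>\<^sub>i\<close> and \<open>\<eta> x\<^sub>i\<close> and their primed
  versions, all of which are polynomials in \<open>x\<close> and \<open>\<xi>\<close>.
\<close>

lemma cross_eigenvalue_identity:
  assumes F: "flag b c x \<xi>" and G: "flag b c x' \<xi>'"
  shows "(cross_eigenvalue b x \<xi> * x' $ i - x $ i * cross_eigenvalue b x' \<xi>')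
      * (cross_eigenvalue c \<xi> x * \<xi>' $ i + \<xi> $ i * cross_eigenvalue c \<xi>' x') =
      - (c $ (i + 2) * b $ (i + 2) - c $ (i + 1) * b $ (i + 1)) *
         (\<xi> $ (i + 1) * \<xi>' $ (i + 2) - \<xi> $ (i + 2) * \<xi>' $ (i + 1)) *
         (x $ (i + 1) * x' $ (i + 2) + x $ (i + 2) * x' $ (i + 1))"
proof -
  define y y' \<eta> \<eta>' where roots: "y = cross_eigenvalue b x \<xi>" "y' = cross_eigenvalue b x' \<xi>'"
    "\<eta> = cross_eigenvalue c \<xi> x" "\<eta>' = cross_eigenvalue c \<xi>' x'"
  have F': "flag c b \<xi> x" and G': "flag c b \<xi>' x'" using F G by (simp_all add: flag_swap)
  note r = cross_eigenvector_nth[OF F, of i, folded roots]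
      cross_eigenvector_nth[OF F', of i, folded roots]
     cross_eigenvector_nth[OF G, of i, folded roots]
         cross_eigenvector_nth[OF G', of i, folded roots]
  have x0: "x $ i * \<xi> $ i = - (x $ (i + 1) * \<xi> $ (i + 1) + x $ (i + 2) * \<xi> $ (i + 2))"
      "x' $ i * \<xi>' $ i = - (x' $ (i + 1) * \<xi>' $ (i + 1) + x' $ (i + 2) * \<xi>' $ (i + 2))"
    using F G by (simp_all add: flag_def inner_cyclic[of _ _ i])
  have "(y * x' $ i - x $ i * y') * (\<eta> * \<xi>' $ i + \<xi> $ i * \<eta>') =
      (y * \<eta>) * (x' $ i * \<xi>' $ i) + (y * \<xi> $ i) * (\<eta>' * x' $ i) - (y' * \<xi>' $ i)
          * (\<eta> * x $ i) - (y' * \<eta>') * (x $ i * \<xi> $ i)"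
    by algebra
  also have "\<dots> = - (c $ (i + 2) * b $ (i + 2) - c $ (i + 1) * b $ (i + 1)) *
         (\<xi> $ (i + 1) * \<xi>' $ (i + 2) - \<xi> $ (i + 2) * \<xi>' $ (i + 1)) *
         (x $ (i + 1) * x' $ (i + 2) + x $ (i + 2) * x' $ (i + 1))"
    unfolding cross_eigenvalue_mult[OF F, of i, folded roots]
        cross_eigenvalue_mult[OF G, of i, folded roots] r[symmetric] x0
    by algebra
  finally show ?thesis unfolding roots .
qed

text \<open>
  The ratios computed from \<open>(x, y)\<close> and from \<open>(\<xi>, \<eta>)\<close> have the same zeros and poles on the curve of
  flags, hence differ by constants. Concretely, the four cross products of numerators and
  denominators are polynomial consequences of the eigenvector equations.
\<close>

lemma offset_dual:
  assumes reg: "regular_pair b c" and F: "flag b c x \<xi>" and G: "flag b c x' \<xi>'"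
    and off: "offset b c \<rho> \<sigma> x (cross_eigenvalue b x \<xi>) x' (cross_eigenvalue b x' \<xi>')"
  shows "offset c b (\<lambda>i. - (c $ i / b $ i) * \<rho> i) \<sigma> \<xi> (cross_eigenvalue c \<xi> x) \<xi>'
      (cross_eigenvalue c \<xi>' x')"
proof -
  define y y' \<eta> \<eta>' where roots: "y = cross_eigenvalue b x \<xi>" "y' = cross_eigenvalue b x' \<xi>'"
    "\<eta> = cross_eigenvalue c \<xi> x" "\<eta>' = cross_eigenvalue c \<xi>' x'"
  have F': "flag c b \<xi> x" and G': "flag c b \<xi>' x'" using F G by (simp_all add: flag_swap)
  note rF = cross_eigenvector_nth[OF F, folded roots] cross_eigenvector_nth[OF F', folded roots]
  note rG = cross_eigenvector_nth[OF G, folded roots] cross_eigenvector_nth[OF G', folded roots]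
  define A where "A i = y * x' $ i - x $ i * y'" for i
  define B where "B i = x $ (i + 1) * x' $ (i + 2) + x $ (i + 2) * x' $ (i + 1)" for i
  define C where "C i = b $ i * (b $ (i + 2) * c $ (i + 2) - b $ (i + 1) * c $ (i + 1)) *
         (x $ (i + 1) * x' $ (i + 2) - x $ (i + 2) * x' $ (i + 1))" for i
  define E where "E i = c $ i * (y * x' $ i + x $ i * y')" for i
  define A' where "A' i = \<eta> * \<xi>' $ i - \<xi> $ i * \<eta>'" for i
  define B' where "B' i = \<xi> $ (i + 1) * \<xi>' $ (i + 2) + \<xi> $ (i + 2) * \<xi>' $ (i + 1)" for i
  define C' where "C' i = c $ i * (c $ (i + 2) * b $ (i + 2) - c $ (i + 1) * b $ (i + 1)) *
         (\<xi> $ (i + 1) * \<xi>' $ (i + 2) - \<xi> $ (i + 2) * \<xi>' $ (i + 1))" for i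
  define E' where "E' i = b $ i * (\<eta> * \<xi>' $ i + \<xi> $ i * \<eta>')" for i
  have "\<sigma> i * A' i = - (c $ i / b $ i) * \<rho> i * B' i
      \<and> \<sigma> i * C' i = - (c $ i / b $ i) * \<rho> i * E' i" for i
  proof -
    note rs = rF[of i] rF[of "i+1", simplified] rF[of "i+2", simplified]
      rG[of i] rG[of "i+1", simplified] rG[of "i+2", simplified]
    have o: "x $ i * \<xi> $ i + x $ (i + 1) * \<xi> $ (i + 1) + x $ (i + 2) * \<xi> $ (i + 2) = 0"
      "x' $ i * \<xi>' $ i + x' $ (i + 1) * \<xi>' $ (i + 1) + x' $ (i + 2) * \<xi>' $ (i + 2) = 0"
      using F G by (simp_all add: flag_def inner_cyclic[of _ _ i])
    have s: "\<sigma> i * A i = \<rho> i * B i" "\<sigma> i * C i = \<rho> i * E i"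
      using off by (auto simp: offset_def A_def B_def C_def E_def roots)
    have I1: "b $ i * A' i * B i = - c $ i * A i * B' i"
      unfolding A_def B_def A'_def B'_def using rs by algebra
    have I4: "(y * x' $ i + x $ i * y') * (\<xi> $ (i + 1) * \<xi>' $ (i + 2) - \<xi> $ (i + 2)
        * \<xi>' $ (i + 1)) * c $ i
      = - (\<eta> * \<xi>' $ i + \<xi> $ i * \<eta>') * (x $ (i + 1) * x' $ (i + 2) - x $ (i + 2) * x' $ (i + 1))
          * b $ i"
      using rs by algebra
    note I2 = cross_eigenvalue_identity[OF F' G', of i, folded roots]
      and I3 = cross_eigenvalue_identity[OF F G, of i, folded roots]
    have bc: "b $ i \<noteq> 0" "c $ i \<noteq> 0" using regular_pairD[OF reg] by auto
    have J1: "b $ i * A' i * B i = - c $ i * A i * B' i" by (rule I1)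
    have J2: "b $ i * A' i * E i = - c $ i * C i * B' i" unfolding A'_def E_def C_def B'_def
        using I2 by algebra
    have J3: "b $ i * C' i * B i = - c $ i * A i * E' i" unfolding A_def B_def C'_def E'_def
        using I3 by algebra
    have J4: "b $ i * C' i * E i = - c $ i * C i * E' i" unfolding C_def E_def C'_def E'_def
        using I4 by algebra
    have "A i \<noteq> 0 \<or> B i \<noteq> 0 \<or> C i \<noteq> 0 \<or> E i \<noteq> 0"
      using offset_nonzero[OF reg on_cover_flag[OF F] on_cover_flag[OF G], of i]
          unfolding A_def B_def C_def E_def roots .
    hence "b $ i * (\<sigma> i * A' i) = - c $ i * \<rho> i * B' i"
        "b $ i * (\<sigma> i * C' i) = - c $ i * \<rho> i * E' i"
      using s J1 J2 J3 J4 by algebra+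
    thus ?thesis using bc by (simp add: field_simps)
  qed
  thus ?thesis unfolding offset_def A'_def B'_def C'_def E'_def roots by blast
qed

text \<open>
  Eliminating \<open>\<rho>\<close> and \<open>\<sigma>\<close> leaves equations that are linear in the Pluecker coordinates of the line
  through \<open>(x', y')\<close> and \<open>(x'', y'')\<close>: each of them, multiplied by the two complementary coordinates
  of \<open>(x, y)\<close>, is zero. If a coordinate of \<open>(x, y)\<close> vanishes, this still suffices unless the same
  coordinate of the other two points vanishes too; in that case all three points differ by sign
  changes, and the mixed equations exclude different signs.
\<close>

lemma offset_unique:
  assumes reg: "regular_pair b c" and P: "on_cover b c x y" and Q: "on_cover b c x' y'"
    and nz: "\<forall>i. \<rho> i \<noteq> 0 \<or> \<sigma> i \<noteq> 0"
    and off: "offset b c \<rho> \<sigma> x y x' y'" "offset b c \<rho> \<sigma> x y x'' y''"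
  shows "\<exists>r. x'' = r *\<^sub>R x'"
proof -
  define A A' where "A i = y * x' $ i - x $ i * y'" and "A' i = y * x'' $ i - x $ i * y''" for i
  define B B' where "B i = x $ (i + 1) * x' $ (i + 2) + x $ (i + 2) * x' $ (i + 1)"
    and "B' i = x $ (i + 1) * x'' $ (i + 2) + x $ (i + 2) * x'' $ (i + 1)" for i
  define C C' where "C i = x $ (i + 1) * x' $ (i + 2) - x $ (i + 2) * x' $ (i + 1)"
    and "C' i = x $ (i + 1) * x'' $ (i + 2) - x $ (i + 2) * x'' $ (i + 1)" for i
  define E E' where "E i = y * x' $ i + x $ i * y'" and "E' i = y * x'' $ i + x $ i * y''" for i
  note d = regular_pairD[OF reg]
  have relns: "A i * B' i = A' i * B i" "C i * E' i = C' i * E i"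
    "b $ i * (b $ (i + 2) * c $ (i + 2) - b $ (i + 1) * c $ (i + 1)) * C' i * B i
        = c $ i * A i * E' i"
    "b $ i * (b $ (i + 2) * c $ (i + 2) - b $ (i + 1) * c $ (i + 1)) * B' i * C i
        = c $ i * A' i * E i" for i
  proof -
    define k where "k = b $ i * (b $ (i + 2) * c $ (i + 2) - b $ (i + 1) * c $ (i + 1))"
    have s: "\<sigma> i * A i = \<rho> i * B i" "\<sigma> i * A' i = \<rho> i * B' i"
        "\<sigma> i * (k * C i) = \<rho> i * (c $ i * E i)" "\<sigma> i * (k * C' i) = \<rho> i * (c $ i * E' i)"
      using off unfolding offset_def A_def B_def C_def E_def A'_def B'_def C'_def E'_def k_def by
          blast+
    have n: "\<rho> i \<noteq> 0 \<or> \<sigma> i \<noteq> 0" using nz by blast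
    have "A i * B' i = A' i * B i" "k * c $ i * (C i * E' i - C' i * E i) = 0"
     "k * C' i * B i = c $ i * A i * E' i" "k * B' i * C i = c $ i * A' i * E i"
      using s n by algebra+
    moreover have "k * c $ i \<noteq> 0" using d(1,2)[of i] d(3)[of "i+2" "i+1"] by (simp add: k_def)
    ultimately show "A i * B' i = A' i * B i" "C i * E' i = C' i * E i"
    "b $ i * (b $ (i + 2) * c $ (i + 2) - b $ (i + 1) * c $ (i + 1)) * C' i * B i
        = c $ i * A i * E' i"
    "b $ i * (b $ (i + 2) * c $ (i + 2) - b $ (i + 1) * c $ (i + 1)) * B' i * C i
        = c $ i * A' i * E i"
      by (simp_all add: k_def)
  qed
  \<comment> \<open>the Pluecker coordinates; those with the index of \<open>y\<close> are called \<open>q\<close>\<close>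
  define p where "p i j = x' $ i * x'' $ j - x' $ j * x'' $ i" for i j
  define q where "q i = x' $ i * y'' - y' * x'' $ i" for i
  have two: "y * x $ (i + 2) * p i (i + 1) = - x $ i * x $ (i + 1) * q (i + 2)"
    "y * x $ (i + 1) * p i (i + 2) = - x $ i * x $ (i + 2) * q (i + 1)" for i
    using relns(1,2)[of i] unfolding A_def B_def C_def E_def A'_def B'_def C'_def E'_def p_def q_def
    by algebra+
  have p_sym: "p i j = - p j i" for i j by (simp add: p_def)
  have pl: "y * x $ i * p (i + 1) (i + 2) = 0" "x $ (i + 1) * x $ (i + 2) * q i = 0" for i
    using two(1)[of "i+1", simplified] two(2)[of "i+2", simplified] p_sym[of "i+2" "i+1"]
        by (algebra, algebra)
  \<comment> \<open>the case of points that differ by sign changes only\<close>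
  have squares: "p (i + 1) (i + 2) = 0"
    if z: "A i * E' i = 0" "A' i * E i = 0" and n: "x $ (i+1) \<noteq> 0" "x $ (i+2) \<noteq> 0"
        "x' $ (i+1) \<noteq> 0" "x' $ (i+2) \<noteq> 0"
      and sq: "(x $ (i+1))\<^sup>2 * (x' $ (i+2))\<^sup>2 = (x $ (i+2))\<^sup>2 * (x' $ (i+1))\<^sup>2" for i
  proof -
    have k: "b $ i * (b $ (i + 2) * c $ (i + 2) - b $ (i + 1) * c $ (i + 1)) \<noteq> 0"
      using d(1)[of i] d(3)[of "i+2" "i+1"] by simp
    have "b $ i * (b $ (i + 2) * c $ (i + 2) - b $ (i + 1) * c $ (i + 1)) * (C' i * B i) = 0"
      "b $ i * (b $ (i + 2) * c $ (i + 2) - b $ (i + 1) * c $ (i + 1)) * (B' i * C i) = 0"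
      using z relns(3,4)[of i] by (simp_all add: mult.assoc)
    with k have bc: "C' i = 0 \<or> B i = 0" "B' i = 0 \<or> C i = 0" by auto
    have "B i * C i = 0" using sq unfolding B_def C_def by algebra
    moreover have "\<not> (B i = 0 \<and> C i = 0)" using n unfolding B_def C_def by auto
    ultimately have "C' i = 0 \<and> C i = 0 \<or> B' i = 0 \<and> B i = 0" using bc by auto
    hence "x $ (i + 1) * p (i + 1) (i + 2) = 0"
    proof
      assume "C' i = 0 \<and> C i = 0"
      thus ?thesis unfolding p_def C_def C'_def by algebra
    next
      assume "B' i = 0 \<and> B i = 0"
      thus ?thesis unfolding p_def B_def B'_def by algebra
    qed
    with n show ?thesis by simp
  qed
  have "p (i + 1) (i + 2) = 0" for i
  proof -
    consider "y \<noteq> 0" "x $ i \<noteq> 0" | "y = 0" | "x $ i = 0" by blast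
    thus ?thesis
    proof cases
      case 1 thus ?thesis using pl(1)[of i] by simp
    next
      case 2
      hence xn: "x $ i \<noteq> 0" for i using on_cover_at_most_one_zero[OF reg P] by blast
      have "q i = 0" for i using pl(2)[of i] xn by simp
      hence q0: "x' $ i * y'' = y' * x'' $ i" for i by (simp add: q_def)
      show ?thesis
      proof (cases "y' = 0 \<and> y'' = 0")
        case True
        hence xn': "x' $ i \<noteq> 0" for i using on_cover_at_most_one_zero[OF reg Q] by blast
        note e = on_cover_cyclic[OF P, of i] on_cover_cyclic[OF Q, of i]
        have "b $ (i+2) * (b $ i * c $ i - b $ (i+1) * c $ (i+1)) *
           ((x $ (i+1))\<^sup>2 * (x' $ (i+2))\<^sup>2 - (x $ (i+2))\<^sup>2 * (x' $ (i+1))\<^sup>2) = 0"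
          using e 2 True by algebra
        hence "(x $ (i+1))\<^sup>2 * (x' $ (i+2))\<^sup>2 = (x $ (i+2))\<^sup>2 * (x' $ (i+1))\<^sup>2"
          using d(1)[of "i+2"] d(3)[of i "i+1"] by simp
        from squares[OF _ _ xn xn xn' xn' this] show ?thesis
          using 2 True by (simp add: A_def A'_def E_def E'_def)
      next
        case False
        have "y' * p (i + 1) (i + 2) = 0" "y'' * p (i + 1) (i + 2) = 0"
          using q0[of "i+1"] q0[of "i+2"] unfolding p_def by algebra+
        with False show ?thesis by auto
      qed
    next
      case 3
      hence xn: "y \<noteq> 0" "x $ (i+1) \<noteq> 0" "x $ (i+2) \<noteq> 0"
        using on_cover_at_most_one_zero[OF reg P, of i] index_neq by blast+
      have p0: "p (i+2) i = 0" "p i (i+1) = 0"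
        using pl(1)[of "i+1"] pl(1)[of "i+2"] xn by simp_all
      show ?thesis
      proof (cases "x' $ i = 0 \<and> x'' $ i = 0")
        case True
        hence xn': "x' $ (i+1) \<noteq> 0" "x' $ (i+2) \<noteq> 0"
          using on_cover_at_most_one_zero(2)[OF reg Q, of i] index_neq by blast+
        have "c $ (i+1) * ((x $ (i+1))\<^sup>2 * (x' $ (i+2))\<^sup>2 - (x $ (i+2))\<^sup>2 * (x' $ (i+1))\<^sup>2) = 0"
          using on_cover_cyclic(1)[OF P, of i] on_cover_cyclic(1)[OF Q, of i] 3 True by algebra
        hence "(x $ (i+1))\<^sup>2 * (x' $ (i+2))\<^sup>2 = (x $ (i+2))\<^sup>2 * (x' $ (i+1))\<^sup>2"
          using d(2)[of "i+1"] by simp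
        from squares[OF _ _ xn(2,3) xn' this] show ?thesis
          using 3 True by (simp add: A_def A'_def E_def E'_def)
      next
        case False
        have "x' $ i * p (i + 1) (i + 2) = 0" "x'' $ i * p (i + 1) (i + 2) = 0"
          using p0 unfolding p_def by algebra+
        with False show ?thesis by auto
      qed
    qed
  qed
  hence "cross3 x' x'' = 0" by (simp add: vec_eq_iff cross3_nth p_def)
  thus ?thesis using parallel_if_cross_zero Q by (auto simp: on_cover_def)
qed

section \<open>Poncelet's closure theorem\<close>

text \<open>
  Change of the point on the line, followed by a change of the line through the new point. The
  conditions on the signs force the other point and the other line, with multiplicity: on a tangent
  line of the conic \<open>\<eta> = 0\<close>, and the point stays.
\<close>

definition poncelet_step :: "real ^ 3 \<Rightarrow> real ^ 3 \<Rightarrow> (real ^ 3) \<times> (real ^ 3) \<Rightarrow> (real ^ 3) \<times> (real ^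
    3) \<Rightarrow> bool" where
  "poncelet_step b c = (\<lambda>(x, \<xi>) (x', \<xi>').
     flag b c x \<xi> \<and> flag b c x' \<xi> \<and> flag b c x' \<xi>' \<and>
     cross_eigenvalue c \<xi> x' = - cross_eigenvalue c \<xi> x
         \<and> cross_eigenvalue b x' \<xi>' = - cross_eigenvalue b x' \<xi>)"

definition flag_offset :: "real ^ 3 \<Rightarrow> real ^ 3 \<Rightarrow> (3 \<Rightarrow> real) \<Rightarrow> (3 \<Rightarrow> real) \<Rightarrow>
    (real ^ 3) \<times> (real ^ 3) \<Rightarrow> (real ^ 3) \<times> (real ^ 3) \<Rightarrow> bool" where
  "flag_offset b c \<rho> \<sigma> = (\<lambda>(x, \<xi>) (x', \<xi>'). offset b c \<rho> \<sigma> x (cross_eigenvalue b x \<xi>) x'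
      (cross_eigenvalue b x' \<xi>'))"

lemma offset_change_line:
  assumes "regular_pair b c" "offset b c \<rho> \<sigma> x (cross_eigenvalue b x \<xi>) x' (cross_eigenvalue b x'
      \<xi>')"
    and "cross_eigenvalue b x \<zeta> = - cross_eigenvalue b x \<xi>"
        "cross_eigenvalue b x' \<zeta>' = - cross_eigenvalue b x' \<xi>'"
  shows "offset b c (\<lambda>i. - \<rho> i) \<sigma> x (cross_eigenvalue b x \<zeta>) x' (cross_eigenvalue b x' \<zeta>')"
  using offset_minus[OF assms(2)] assms(3,4) by simp

text \<open>
  The change of points is a change of sign of \<open>\<eta>\<close> and the change of lines one of \<open>y\<close>; in either form
  of the ratios it reverses the sign of all of them, and two reversals cancel.
\<close>

lemma poncelet_step_offset:
  assumes reg: "regular_pair b c" and off: "flag_offset b c \<rho> \<sigma> S T"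
    and st: "poncelet_step b c S S'" "poncelet_step b c T T'"
  shows "flag_offset b c \<rho> \<sigma> S' T'"
proof -
  obtain x \<xi> z \<zeta> x' \<xi>' z' \<zeta>' where e: "S = (x, \<xi>)" "S' = (z, \<zeta>)" "T = (x', \<xi>')" "T' = (z', \<zeta>')"
    by (metis surj_pair)
  note st = st[unfolded e poncelet_step_def prod.case]
  note off = off[unfolded e flag_offset_def prod.case]
  have reg': "regular_pair c b" using reg regular_pair_swap by blast
  have o1: "offset c b (\<lambda>i. - (c $ i / b $ i)
      * \<rho> i) \<sigma> \<xi> (cross_eigenvalue c \<xi> x) \<xi>' (cross_eigenvalue c \<xi>' x')"
    using offset_dual[OF reg _ _ off] st by blast
  have o2: "offset c b (\<lambda>i. - (- (c $ i / b $ i)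
      * \<rho> i)) \<sigma> \<xi> (cross_eigenvalue c \<xi> z) \<xi>' (cross_eigenvalue c \<xi>' z')"
    by (rule offset_change_line[OF reg' o1]) (use st in auto)
  have "offset b c (\<lambda>i. - (b $ i / c $ i) * (- (- (c $ i / b $ i)
      * \<rho> i))) \<sigma> z (cross_eigenvalue b z \<xi>) z' (cross_eigenvalue b z' \<xi>')"
    by (rule offset_dual[OF reg' _ _ o2]) (use st flag_swap in auto)
  moreover have "- (b $ i / c $ i) * (- (- (c $ i / b $ i) * \<rho> i)) = - \<rho> i" for i
    using regular_pairD(1,2)[OF reg, of i] by simp
  ultimately have "offset b c (\<lambda>i. - \<rho> i) \<sigma> z (cross_eigenvalue b z \<xi>) z' (cross_eigenvalue b z'
      \<xi>')" by simp
  from offset_change_line[OF reg this, of \<zeta> \<zeta>'] st show ?thesis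
    by (simp add: e flag_offset_def)
qed

lemma poncelet_chain_offset:
  assumes reg: "regular_pair b c"
  shows "(poncelet_step b c ^^ n) S S' \<Longrightarrow> (poncelet_step b c ^^ n) T T' \<Longrightarrow> flag_offset b c \<rho> \<sigma> S T
    \<Longrightarrow> flag_offset b c \<rho> \<sigma> S' T'"
proof (induction n arbitrary: S' T')
  case (Suc n)
  obtain U where U: "(poncelet_step b c ^^ n) S U" "poncelet_step b c U S'"
    using Suc.prems(1) by (rule relpowp_Suc_E)
  obtain V where V: "(poncelet_step b c ^^ n) T V" "poncelet_step b c V T'"
    using Suc.prems(2) by (rule relpowp_Suc_E)
  from poncelet_step_offset[OF reg Suc.IH[OF U(1) V(1) Suc.prems(3)] U(2) V(2)] show ?case .
qed auto

lemma poncelet_chain_flags: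
  assumes "(poncelet_step b c ^^ n) S S'" "n > 0"
  shows "flag b c (fst S) (snd S)" "flag b c (fst S') (snd S')"
proof -
  obtain m where m: "n = Suc m" using assms(2) gr0_implies_Suc by blast
  obtain U where "(poncelet_step b c ^^ m) S U" "poncelet_step b c U S'"
    using assms(1) m by (meson relpowp_Suc_E)
  thus "flag b c (fst S') (snd S')" by (auto simp: poncelet_step_def)
  obtain U where "poncelet_step b c S U"
    using assms(1) m by (meson relpowp_Suc_E2)
  thus "flag b c (fst S) (snd S)" by (auto simp: poncelet_step_def)
qed

text \<open>
  The closed chain and the other chain keep their difference. After \<open>n\<close> steps the closed chain is
  back, hence the other one is at a flag with the same difference to the same flag. The conclusion
  is projective, since a step does not fix the scale of the vectors.
\<close>

theorem poncelet_porism: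
  assumes reg: "regular_pair b c" and n: "n > 0"
    and S: "(poncelet_step b c ^^ n) S S" and T: "(poncelet_step b c ^^ n) (x, \<xi>) (x', \<xi>')"
  shows "(\<exists>r. x' = r *\<^sub>R x) \<and> (\<exists>r. \<xi>' = r *\<^sub>R \<xi>)"
proof -
  obtain z \<zeta> where e: "S = (z, \<zeta>)" by (metis surj_pair)
  have fl: "flag b c z \<zeta>" "flag b c x \<xi>" "flag b c x' \<xi>'"
    using poncelet_chain_flags[OF S n] poncelet_chain_flags[OF T n] e by auto
  note cv = fl[THEN on_cover_flag] fl[unfolded flag_swap[of b], THEN on_cover_flag]
  have reg': "regular_pair c b" using reg regular_pair_swap by blast
  obtain \<rho> \<sigma> where rs: "\<forall>i. \<rho> i \<noteq> 0 \<or> \<sigma> i \<noteq> 0"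
      "offset b c \<rho> \<sigma> z (cross_eigenvalue b z \<zeta>) x (cross_eigenvalue b x \<xi>)"
    using offset_exists[OF reg cv(1,2)] by blast
  have "flag_offset b c \<rho> \<sigma> S (x', \<xi>')"
    by (rule poncelet_chain_offset[OF reg S T]) (use rs in \<open>simp add: e flag_offset_def\<close>)
  hence rs': "offset b c \<rho> \<sigma> z (cross_eigenvalue b z \<zeta>) x' (cross_eigenvalue b x' \<xi>')"
      by (simp add: e flag_offset_def)
  have "\<forall>i. - (c $ i / b $ i) * \<rho> i \<noteq> 0 \<or> \<sigma> i \<noteq> 0"
    using rs(1) regular_pairD(1,2)[OF reg] by auto
  from offset_unique[OF reg' cv(4,5) this offset_dual[OF reg fl(1,2) rs(2)]
      offset_dual[OF reg fl(1,3) rs']]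
  show ?thesis using offset_unique[OF reg cv(1,2) rs(1,2) rs'] by blast
qed

section \<open>The Lorentz form and the confocal forms\<close>

definition signs :: "real ^ 3" where
  "signs = (\<chi> i. if i = 0 then - 1 else 1)"

definition confocal_coeffs :: "real ^ 3 \<Rightarrow> real \<Rightarrow> real ^ 3" where
  "confocal_coeffs a \<mu> = (\<chi> i. signs $ i / (a $ i - \<mu>))"

lemma signs_nth: "signs $ 0 = -1" "signs $ 1 = 1" "signs $ 2 = 1"
  by (simp_all add: signs_def)

lemma signs_square: "signs $ i * signs $ i = 1" "signs $ i \<noteq> 0"
  by (simp_all add: signs_def)

lemma mink_inner: "mink x y = x \<bullet> (signs * y)"
  by (simp add: mink_def inner_cyclic[of _ _ 0] signs_nth)

lemma confocal_form_inner: "confocal_form a \<mu> x y = x \<bullet> (confocal_coeffs a \<mu> * y)"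
  by (simp add: confocal_form_def mink_inner resolvent_def confocal_coeffs_def inner_cyclic[of _ _
      0] signs_nth)

lemma mink_commute: "mink x y = mink y x"
  by (simp add: mink_def mult.commute)

lemma confocal_form_commute: "confocal_form a \<mu> x y = confocal_form a \<mu> y x"
  by (simp add: confocal_form_def mink_def resolvent_def mult_ac)

lemma mink_linear:
  "mink (x + y) z = mink x z + mink y z" "mink (x - y) z = mink x z - mink y z"
  "mink z (x + y) = mink z x + mink z y" "mink z (x - y) = mink z x - mink z y"
  "mink (r *\<^sub>R x) z = r * mink x z" "mink z (r *\<^sub>R x) = r * mink z x"
  "mink (- x) z = - mink x z" "mink z (- x) = - mink z x"
  by (simp_all add: mink_def algebra_simps)

lemma confocal_form_linear:
  "confocal_form a \<mu> z (x + y) = confocal_form a \<mu> z x + confocal_form a \<mu> z y"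
  "confocal_form a \<mu> z (x - y) = confocal_form a \<mu> z x - confocal_form a \<mu> z y"
  "confocal_form a \<mu> z (r *\<^sub>R x) = r * confocal_form a \<mu> z x"
  "confocal_form a \<mu> z (- x) = - confocal_form a \<mu> z x"
  "confocal_form a \<mu> (x + y) z = confocal_form a \<mu> x z + confocal_form a \<mu> y z"
  "confocal_form a \<mu> (x - y) z = confocal_form a \<mu> x z - confocal_form a \<mu> y z"
  "confocal_form a \<mu> (r *\<^sub>R x) z = r * confocal_form a \<mu> x z"
  "confocal_form a \<mu> (- x) z = - confocal_form a \<mu> x z"
  by (simp_all add: confocal_form_def mink_def resolvent_def algebra_simps add_divide_distrib
      diff_divide_distrib)

lemma bounded_bilinear_mink: "bounded_bilinear mink"
  by (intro bilinear_conv_bounded_bilinear[THEN iffD1]) (auto simp: bilinear_def linear_iff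
      mink_linear)

lemma bounded_bilinear_confocal_form: "bounded_bilinear (confocal_form a \<mu>)"
  by (intro bilinear_conv_bounded_bilinear[THEN iffD1]) (auto simp: bilinear_def linear_iff
      confocal_form_linear)

section \<open>Geodesics of the hyperboloid\<close>

lemma constant_on_interval:
  fixes f :: "real \<Rightarrow> 'a::real_normed_vector"
  assumes "\<And>t. t \<in> {0..T} \<Longrightarrow> (f has_vector_derivative 0) (at t within {0..T})" "t \<in> {0..T}"
  shows "f t = f 0"
proof -
  have "\<exists>c. \<forall>x\<in>{0..T}. f x = c"
    using has_derivative_zero_constant[of "{0..T}" f] assms(1)
        by (auto simp: has_vector_derivative_def)
  thus ?thesis using assms(2) by auto
qed

lemma derivative_zero_if_constant:
  fixes f :: "real \<Rightarrow> real"
  assumes "0 < T" "t \<in> {0..T}" "(f has_vector_derivative d) (at t within {0..T})"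
      "\<And>s. s \<in> {0..T} \<Longrightarrow> f s = k"
  shows "d = 0"
proof -
  have "((\<lambda>_. k) has_vector_derivative d) (at t within {0..T})"
    by (rule has_vector_derivative_transform[OF assms(2) _ assms(3)]) (use assms(4) in auto)
  moreover have "((\<lambda>_. k) has_vector_derivative 0) (at t within {0..T})" by simp
  ultimately show ?thesis
    using vector_derivative_unique_within_closed_interval[of 0 T] assms(1,2) by (metis box_real(2))
qed

context
  fixes T :: real and \<gamma> \<gamma>' :: "real \<Rightarrow> real ^ 3"
  assumes T: "0 < T" and geo: "geodesic_on {0..T} \<gamma> \<gamma>'"
begin

lemma geodesic_derivs:
  assumes "t \<in> {0..T}"
  shows "mink (\<gamma> t) (\<gamma> t) = 1" "(\<gamma> has_vector_derivative \<gamma>' t) (at t within {0..T})"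
    "\<exists>c. (\<gamma>' has_vector_derivative c *\<^sub>R \<gamma> t) (at t within {0..T})"
  using geo assms by (auto simp: geodesic_on_def hyperboloid_def)

lemma geodesic_orthogonal:
  assumes "t \<in> {0..T}"
  shows "mink (\<gamma> t) (\<gamma>' t) = 0"
proof -
  note d = geodesic_derivs(2)[OF assms]
  from derivative_zero_if_constant[OF T assms bounded_bilinear.has_vector_derivative[OF
      bounded_bilinear_mink d d] geodesic_derivs(1)]
  show ?thesis by (simp add: mink_commute)
qed

text \<open>
  The acceleration is parallel to the position, so the plane through the origin is constant together
  with its normal vector of definite length.
\<close>

lemma geodesic_cross:
  assumes "t \<in> {0..T}"
  shows "cross3 (\<gamma> t) (\<gamma>' t) = cross3 (\<gamma> 0) (\<gamma>' 0)"
proof (rule constant_on_interval[OF _ assms])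
  fix t assume t: "t \<in> {0..T}"
  then obtain c where c: "(\<gamma>' has_vector_derivative c *\<^sub>R \<gamma> t) (at t within {0..T})"
      using geodesic_derivs(3) by blast
  have "bounded_bilinear cross3" using bilinear_cross by (simp add: bilinear_conv_bounded_bilinear)
  from bounded_bilinear.has_vector_derivative[OF this geodesic_derivs(2)[OF t] c]
  show "((\<lambda>t. cross3 (\<gamma> t) (\<gamma>' t)) has_vector_derivative 0) (at t within {0..T})"
    by (simp add: cross_mult_right)
qed

lemma geodesic_speed:
  assumes "t \<in> {0..T}"
  shows "mink (\<gamma>' t) (\<gamma>' t) = mink (\<gamma>' 0) (\<gamma>' 0)"
proof (rule constant_on_interval[OF _ assms])
  fix t assume t: "t \<in> {0..T}"
  then obtain c where c: "(\<gamma>' has_vector_derivative c *\<^sub>R \<gamma> t) (at t within {0..T})"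
      using geodesic_derivs(3) by blast
  from bounded_bilinear.has_vector_derivative[OF bounded_bilinear_mink c c]
      geodesic_orthogonal[OF t]
  show "((\<lambda>t. mink (\<gamma>' t) (\<gamma>' t)) has_vector_derivative 0) (at t within {0..T})"
    by (simp add: mink_linear mink_commute)
qed

text \<open>
  The factor of proportionality is found by differentiating the orthogonality of position and
  velocity.
\<close>

lemma geodesic_second_derivative:
  assumes t: "t \<in> {0..T}"
  shows "(\<gamma>' has_vector_derivative - mink (\<gamma>' 0) (\<gamma>' 0) *\<^sub>R \<gamma> t) (at t within {0..T})"
proof -
  from t obtain c where c: "(\<gamma>' has_vector_derivative c *\<^sub>R \<gamma> t) (at t within {0..T})"
      using geodesic_derivs(3) by blast
  from derivative_zero_if_constant[OF T t bounded_bilinear.has_vector_derivative[OF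
      bounded_bilinear_mink geodesic_derivs(2)[OF t] c] geodesic_orthogonal]
  have "c + mink (\<gamma>' 0) (\<gamma>' 0) = 0"
    by (simp add: mink_linear geodesic_derivs(1)[OF t] geodesic_speed[OF t])
  hence "c = - mink (\<gamma>' 0) (\<gamma>' 0)" by simp
  with c show ?thesis by simp
qed

text \<open>
  Here \<open>C\<close> and \<open>S\<close> stand for the solutions of \<open>f'' = - E f\<close>, with \<open>E\<close> the squared speed, that start
  like cosine and sine. Undoing the evolution with them gives two constant vectors, the initial
  position and velocity; this replaces a uniqueness theorem for differential equations.
\<close>

lemma geodesic_eq_combination:
  fixes C S :: "real \<Rightarrow> real"
  assumes C: "\<And>t. (C has_real_derivative - mink (\<gamma>' 0) (\<gamma>' 0) * S t) (at t)"
    and S: "\<And>t. (S has_real_derivative C t) (at t)"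
    and init: "C 0 = 1" "S 0 = 0" "\<And>t. (C t)\<^sup>2 + mink (\<gamma>' 0) (\<gamma>' 0) * (S t)\<^sup>2 = 1"
        and t: "t \<in> {0..T}"
  shows "\<gamma> t = C t *\<^sub>R \<gamma> 0 + S t *\<^sub>R \<gamma>' 0"
proof -
  let ?E = "mink (\<gamma>' 0) (\<gamma>' 0)"
  have C': "(C has_vector_derivative - ?E * S t) (at t within {0..T})"
    and S': "(S has_vector_derivative C t) (at t within {0..T})" for t
    using C[of t] S[of t] has_real_derivative_iff_has_vector_derivative
        has_vector_derivative_at_within by blast+
  have 1: "C t *\<^sub>R \<gamma> t - S t *\<^sub>R \<gamma>' t = C 0 *\<^sub>R \<gamma> 0 - S 0 *\<^sub>R \<gamma>' 0"
  proof (rule constant_on_interval[OF _ t])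
    fix s assume s: "s \<in> {0..T}"
    note * = has_vector_derivative_diff[OF bounded_bilinear.has_vector_derivative[OF
        bounded_bilinear_scaleR C' geodesic_derivs(2)[OF s]]
      bounded_bilinear.has_vector_derivative[OF bounded_bilinear_scaleR S'
          geodesic_second_derivative[OF s]]]
    show "((\<lambda>t. C t *\<^sub>R \<gamma> t - S t *\<^sub>R \<gamma>' t) has_vector_derivative 0) (at s within {0..T})"
      using * by (simp add: mult.commute)
  qed
  have 2: "(?E * S t) *\<^sub>R \<gamma> t + C t *\<^sub>R \<gamma>' t = (?E * S 0) *\<^sub>R \<gamma> 0 + C 0 *\<^sub>R \<gamma>' 0"
  proof (rule constant_on_interval[OF _ t])
    fix s assume s: "s \<in> {0..T}"
    have "((\<lambda>t. ?E * S t) has_vector_derivative ?E * C s) (at s within {0..T})"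
      using has_vector_derivative_mult_right[OF S'] by simp
    note * = has_vector_derivative_add[OF bounded_bilinear.has_vector_derivative[OF
        bounded_bilinear_scaleR this geodesic_derivs(2)[OF s]]
      bounded_bilinear.has_vector_derivative[OF bounded_bilinear_scaleR C'
          geodesic_second_derivative[OF s]]]
    show "((\<lambda>t. (?E * S t) *\<^sub>R \<gamma> t + C t *\<^sub>R \<gamma>' t) has_vector_derivative 0) (at s within {0..T})"
      using * by (simp add: mult.commute)
  qed
  have "C t *\<^sub>R (C t *\<^sub>R \<gamma> t - S t *\<^sub>R \<gamma>' t) + S t *\<^sub>R ((?E * S t) *\<^sub>R \<gamma> t + C t *\<^sub>R \<gamma>' t)
     = ((C t)\<^sup>2 + ?E * (S t)\<^sup>2) *\<^sub>R \<gamma> t"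
    by (simp add: algebra_simps power2_eq_square)
  thus ?thesis using 1 2 init by simp
qed

text \<open>
  The coefficient of the initial velocity is \<open>t\<close>, \<open>sin (\<omega> t) / \<omega>\<close> or \<open>sinh (\<omega> t) / \<omega>\<close> in the light-,
  space- and time-like case. Under the bound on the length it vanishes again only at the end of a
  space-like arc of length \<open>\<pi>\<close>, which is the antipodal point.
\<close>

lemma geodesic_form:
  assumes len: "mink (\<gamma>' 0) (\<gamma>' 0) > 0 \<longrightarrow> T * sqrt (mink (\<gamma>' 0) (\<gamma>' 0)) \<le> pi"
  obtains C S where "\<And>t. t \<in> {0..T} \<Longrightarrow> \<gamma> t = C t *\<^sub>R \<gamma> 0 + S t *\<^sub>R \<gamma>' 0"
    "\<And>t. t \<in> {0<..<T} \<Longrightarrow> S t > 0" "S T > (0::real) \<or> \<gamma> T = - \<gamma> 0"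
proof -
  define E where "E = mink (\<gamma>' 0) (\<gamma>' 0)"
  consider "E = 0" | "E > 0" | "E < 0" by linarith
  thus ?thesis
  proof cases
    case 1
    have "\<gamma> t = 1 *\<^sub>R \<gamma> 0 + t *\<^sub>R \<gamma>' 0" if "t \<in> {0..T}" for t
    proof (rule geodesic_eq_combination[OF _ _ _ _ _ that], unfold E_def[symmetric])
      show "((\<lambda>t. 1) has_real_derivative - E * t) (at t)" for t :: real
        using 1 by simp
      show "((\<lambda>t. t) has_real_derivative 1) (at t)" for t :: real
        by (rule DERIV_ident)
    qed (simp_all add: 1)
    from that[OF this] T show ?thesis by simp
  next
    case 2
    define \<omega> where "\<omega> = sqrt E"
    have w: "\<omega> > 0" "E = \<omega>\<^sup>2" using 2 by (auto simp: \<omega>_def)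
    have sol: "\<gamma> t = cos (\<omega> * t) *\<^sub>R \<gamma> 0 + (sin (\<omega> * t) / \<omega>) *\<^sub>R \<gamma>' 0" if "t \<in> {0..T}" for t
    proof (rule geodesic_eq_combination[OF _ _ _ _ _ that], unfold E_def[symmetric])
      show "((\<lambda>t. cos (\<omega> * t)) has_real_derivative - E * (sin (\<omega> * t) / \<omega>)) (at t)" for t
        using w by (auto intro!: derivative_eq_intros simp: power2_eq_square)
      show "((\<lambda>t. sin (\<omega> * t) / \<omega>) has_real_derivative cos (\<omega> * t)) (at t)" for t
        using w by (auto intro!: derivative_eq_intros)
      show "(cos (\<omega> * t))\<^sup>2 + E * (sin (\<omega> * t) / \<omega>)\<^sup>2 = 1" for t
        using w by (simp add: power_divide)
    qed simp_all
    have le: "\<omega> * T \<le> pi" using len 2 by (simp add: E_def \<omega>_def mult.commute)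
    have pos: "sin (\<omega> * t) / \<omega> > 0" if "t \<in> {0<..<T}" for t
    proof -
      have "\<omega> * t < \<omega> * T" using that w by simp
      hence "\<omega> * t < pi" using le by linarith
      thus ?thesis using sin_gt_zero[of "\<omega> * t"] le w that by simp
    qed
    have "sin (\<omega> * T) / \<omega> > 0 \<or> \<gamma> T = - \<gamma> 0"
    proof (cases "\<omega> * T = pi")
      case True
      thus ?thesis using sol[of T] T by simp
    next
      case False
      thus ?thesis using sin_gt_zero[of "\<omega> * T"] le w T by simp
    qed
    from that[OF sol pos this] show ?thesis .
  next
    case 3
    define \<omega> where "\<omega> = sqrt (- E)"
    have w: "\<omega> > 0" "E = - \<omega>\<^sup>2" using 3 by (auto simp: \<omega>_def)
    have sol: "\<gamma> t = cosh (\<omega> * t) *\<^sub>R \<gamma> 0 + (sinh (\<omega> * t) / \<omega>) *\<^sub>R \<gamma>' 0" if "t \<in> {0..T}" for t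
    proof (rule geodesic_eq_combination[OF _ _ _ _ _ that], unfold E_def[symmetric])
      show "((\<lambda>t. cosh (\<omega> * t)) has_real_derivative - E * (sinh (\<omega> * t) / \<omega>)) (at t)" for t
        using w by (auto intro!: derivative_eq_intros simp: power2_eq_square)
      show "((\<lambda>t. sinh (\<omega> * t) / \<omega>) has_real_derivative cosh (\<omega> * t)) (at t)" for t
        using w by (auto intro!: derivative_eq_intros)
      show "(cosh (\<omega> * t))\<^sup>2 + E * (sinh (\<omega> * t) / \<omega>)\<^sup>2 = 1" for t
        using w by (simp add: power_divide cosh_square_eq)
    qed simp_all
    have pos: "sinh (\<omega> * t) / \<omega> > 0" if "t > 0" for t
      using that w by simp
    show ?thesis by (rule that[OF sol]) (use pos T in auto)
  qed
qed

end

section \<open>Billiard segments\<close>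

lemma table_points:
  assumes "is_table a D"
  shows "x \<in> table_boundary a D \<Longrightarrow> mink x x = 1 \<and> confocal_form a 0 x x = 0"
    "x \<in> D - table_boundary a D \<Longrightarrow> confocal_form a 0 x x > 0"
  using assms by (auto simp: is_table_def table_boundary_def collared_domain_def
      transverse_domain_def
      hyperboloid_def confocal_cone_def less_le)

lemma derivative_signs_at_ends:
  fixes g :: "real \<Rightarrow> real"
  assumes "0 < T" "g 0 = 0" "g T = 0" "\<And>t. t \<in> {0<..<T} \<Longrightarrow> g t > 0"
  shows "(g has_vector_derivative d) (at 0 within {0..T}) \<Longrightarrow> d \<ge> 0"
    "(g has_vector_derivative d) (at T within {0..T}) \<Longrightarrow> d \<le> 0"
proof -
  show "d \<ge> 0" if dv: "(g has_vector_derivative d) (at 0 within {0..T})"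
  proof (rule ccontr)
    assume "\<not> d \<ge> 0"
    then obtain e where e: "e > 0" "\<And>h. 0 < h \<Longrightarrow> 0 + h \<in> {0..T} \<Longrightarrow> h < e \<Longrightarrow> g 0 > g (0 + h)"
      using has_real_derivative_neg_dec_right[of g d 0 "{0..T}"] dv
      by (auto simp: has_real_derivative_iff_has_vector_derivative)
    define h where "h = min (T / 2) (e / 2)"
    have h: "0 < h" "h < T" "h < e" using e(1) assms(1) by (auto simp: h_def min_def field_simps)
    from e(2)[of h] h assms(2) assms(4)[of h] show False by simp
  qed
  show "d \<le> 0" if dv: "(g has_vector_derivative d) (at T within {0..T})"
  proof (rule ccontr)
    assume "\<not> d \<le> 0"
    then obtain e where e: "e > 0" "\<And>h. 0 < h \<Longrightarrow> T - h \<in> {0..T} \<Longrightarrow> h < e \<Longrightarrow> g (T - h) < g T"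
      using has_real_derivative_pos_inc_left[of g d T "{0..T}"] dv
      by (auto simp: has_real_derivative_iff_has_vector_derivative)
    define h where "h = min (T / 2) (e / 2)"
    have h: "0 < h" "h < T" "h < e" using e(1) assms(1) by (auto simp: h_def min_def field_simps)
    from e(2)[of h] h assms(3) assms(4)[of "T - h"] show False by simp
  qed
qed

text \<open>
  The confocal form is positive inside the segment and zero at its ends, which gives the two signs.
  The last claim holds because a tangent segment satisfies \<open>\<langle>A\<inverse>\<gamma>, \<gamma>\<rangle> = S\<^sup>2 \<langle>A\<inverse>v, v\<rangle>\<close>, which can be
  positive inside and zero at the end only where \<open>S\<close> vanishes.
\<close>

lemma billiard_segment_facts:
  assumes tab: "is_table a D" and seg: "billiard_segment a D x v y w"
  shows "x \<in> table_boundary a D" "y \<in> table_boundary a D"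
    "mink x v = 0" "mink y w = 0" "cross3 y w = cross3 x v" "v \<noteq> 0"
    "confocal_form a 0 x v \<ge> 0" "confocal_form a 0 y w \<le> 0"
    "\<exists>\<alpha> \<beta>. y = \<alpha> *\<^sub>R x + \<beta> *\<^sub>R v \<and> (\<beta> > 0 \<or> y = - x)"
    "confocal_form a 0 x v = 0 \<Longrightarrow> y = - x"
proof -
  let ?B = "confocal_form a 0"
  from seg obtain T \<gamma> \<gamma>' where T: "0 < T" and geo: "geodesic_on {0..T} \<gamma> \<gamma>'"
    and ends: "\<gamma> 0 = x" "\<gamma>' 0 = v" "\<gamma> T = y" "\<gamma>' T = w"
    and inn: "\<And>t. t \<in> {0<..<T} \<Longrightarrow> \<gamma> t \<in> D - table_boundary a D"
    and len: "mink v v > 0 \<longrightarrow> T * sqrt (mink v v) \<le> pi"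
    unfolding billiard_segment_def by blast
  show x: "x \<in> table_boundary a D" and y: "y \<in> table_boundary a D"
      using seg by (auto simp: billiard_segment_def)
  show "mink x v = 0" "mink y w = 0" "cross3 y w = cross3 x v"
    using geodesic_orthogonal[OF T geo, of 0] geodesic_orthogonal[OF T geo, of T]
      geodesic_cross[OF T geo, of T] T by (simp_all add: ends)
  have B0: "?B x x = 0" "?B y y = 0" using table_points(1)[OF tab] x y by auto
  have pos: "?B (\<gamma> t) (\<gamma> t) > 0" if "t \<in> {0<..<T}" for t
      using table_points(2)[OF tab inn[OF that]] .
  have der: "((\<lambda>t. ?B (\<gamma> t) (\<gamma> t)) has_vector_derivative 2 * ?B (\<gamma> t) (\<gamma>' t)) (at t within {0..T})"
    if "t \<in> {0..T}" for t
    using bounded_bilinear.has_vector_derivative[OF bounded_bilinear_confocal_form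
        geodesic_derivs(2)[OF T geo that] geodesic_derivs(2)[OF T geo that], of a 0]
    by (simp add: confocal_form_commute)
  note sgn = derivative_signs_at_ends[of T "\<lambda>t. ?B (\<gamma> t) (\<gamma> t)", OF T _ _ pos]
  show "?B x v \<ge> 0" using sgn(1)[OF _ _ _ der[of 0]] T B0 by (simp add: ends)
  show "?B y w \<le> 0" using sgn(2)[OF _ _ _ der[of T]] T B0 by (simp add: ends)
  obtain C S where form: "\<And>t. t \<in> {0..T} \<Longrightarrow> \<gamma> t = C t *\<^sub>R x + S t *\<^sub>R v"
    "\<And>t. t \<in> {0<..<T} \<Longrightarrow> S t > 0" "S T > (0::real) \<or> y = - x"
    using geodesic_form[OF T geo] len unfolding ends by metis
  have half: "T / 2 \<in> {0<..<T}" "T / 2 \<in> {0..T}" using T by auto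
  show "v \<noteq> 0"
  proof
    assume "v = 0"
    hence "?B (\<gamma> (T / 2)) (\<gamma> (T / 2)) = 0" using form(1)[OF half(2)] B0
        by (simp add: confocal_form_linear)
    with pos[OF half(1)] show False by simp
  qed
  show "\<exists>\<alpha> \<beta>. y = \<alpha> *\<^sub>R x + \<beta> *\<^sub>R v \<and> (\<beta> > 0 \<or> y = - x)"
    using form(1)[of T] form(3) T ends by auto
  show "y = - x" if j: "?B x v = 0"
  proof (rule ccontr)
    assume "y \<noteq> - x"
    hence "S T > 0" using form(3) by blast
    have B: "?B (\<gamma> t) (\<gamma> t) = (S t)\<^sup>2 * ?B v v" if "t \<in> {0..T}" for t
      unfolding form(1)[OF that] using B0 j
      by (simp add: confocal_form_linear confocal_form_commute[of _ _ v x] power2_eq_square)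
    from B[of T] T B0 \<open>S T > 0\<close> have "?B v v = 0" by (simp add: ends)
    with B[OF half(2)] pos[OF half(1)] show False by simp
  qed
qed

section \<open>Segments and reflections as changes of flags\<close>

text \<open>
  The dual conics of the confocal family: up to scale, the value \<open>\<mu>\<close> corresponds to \<open>\<alpha> = 1\<close>,
  \<open>\<beta> = - \<mu>\<close> and the absolute \<open>\<mu> = \<infinity>\<close> to \<open>\<alpha> = 0\<close>, \<open>\<beta> = 1\<close>. The boundary conic belongs to \<open>\<beta> = 0\<close>.
\<close>

definition caustic_coeffs :: "real ^ 3 \<Rightarrow> real \<Rightarrow> real \<Rightarrow> real ^ 3" where
  "caustic_coeffs a \<alpha> \<beta> = (\<chi> i. signs $ i * (\<alpha> * a $ i + \<beta>))"

lemma table_entries: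
  assumes "is_table a D"
  shows "a $ i \<noteq> 0" "i \<noteq> j \<Longrightarrow> a $ i \<noteq> a $ j"
  using assms index_012[of i] index_012[of j]
      by (auto simp: is_table_def collared_def transverse_def)

lemma coeffs_product:
  assumes "is_table a D"
  shows "caustic_coeffs a \<alpha> \<beta> $ i * confocal_coeffs a 0 $ i = \<alpha> + \<beta> / a $ i"
  using table_entries(1)[OF assms, of i] signs_square(1)[of i]
  by (simp add: caustic_coeffs_def confocal_coeffs_def field_simps)

lemma regular_coeffs:
  assumes "is_table a D" "\<beta> \<noteq> 0" "\<And>i. \<alpha> * a $ i + \<beta> \<noteq> 0"
  shows "regular_pair (caustic_coeffs a \<alpha> \<beta>) (confocal_coeffs a 0)"
  unfolding regular_pair_def coeffs_product[OF assms(1)]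
  using table_entries[OF assms(1)] assms(2,3) signs_square(2)
  by (auto simp: inj_def caustic_coeffs_def confocal_coeffs_def)

lemma cross_zero_orthogonal:
  assumes "cross3 x u = 0" "mink x x = 1" "mink x u = 0"
  shows "u = 0"
proof -
  have "x \<noteq> 0" using assms(2) by (auto simp: mink_def)
  from parallel_if_cross_zero[OF assms(1) this] obtain r where u: "u = r *\<^sub>R x" by blast
  with assms show ?thesis by (simp add: mink_linear)
qed

lemma flag_velocity:
  assumes "mink x x = 1" "confocal_form a 0 x x = 0" "mink x v = 0" "v \<noteq> 0"
    and "cross3 x v \<bullet> (b * cross3 x v) = 0"
  shows "flag b (confocal_coeffs a 0) x (cross3 x v)"
  using assms cross_zero_orthogonal[OF _ assms(1,3)]
  by (auto simp: flag_def confocal_form_inner[symmetric] dot_cross_self mink_def)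

lemma cross_velocity_gradient:
  assumes "confocal_form a 0 x x = 0"
  shows "cross3 (cross3 x v) (confocal_coeffs a 0 * x) = - confocal_form a 0 x v *\<^sub>R x"
proof -
  have "cross3 (cross3 x v) (confocal_coeffs a 0 * x)
      = - cross3 (confocal_coeffs a 0 * x) (cross3 x v)"
    by (rule cross_skew)
  also have "\<dots> = - (confocal_form a 0 x v *\<^sub>R x)"
    using assms by (simp add: Cross3.Lagrange confocal_form_inner inner_commute[of
        "confocal_coeffs a 0 * x"])
      (simp add: confocal_form_commute flip: confocal_form_inner)
  finally show ?thesis by simp
qed

lemma cross_eigenvalue_velocity:
  assumes "mink x x = 1" "confocal_form a 0 x x = 0"
  shows "cross_eigenvalue (confocal_coeffs a 0) (cross3 x v) x = - confocal_form a 0 x v"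
  by (rule cross_eigenvalue_eqI[OF cross_velocity_gradient[OF assms(2)]]) (use assms(1) in \<open>auto
      simp: mink_def\<close>)

text \<open>
  Both ends give flags with the same line, and the square of \<open>\<eta>\<close> depends on the line only. The
  velocity points into the table at \<open>x\<close> and out of it at \<open>y\<close>, which decides the sign.
\<close>

lemma joachimsthal_segment:
  assumes tab: "is_table a D" and seg: "billiard_segment a D x v y w"
    and b: "cross3 x v \<bullet> (b * cross3 x v) = 0"
  shows "confocal_form a 0 y w = - confocal_form a 0 x v"
    "flag b (confocal_coeffs a 0) x (cross3 x v)" "flag b (confocal_coeffs a 0) y (cross3 x v)"
proof -
  note f = billiard_segment_facts[OF tab seg]
  note x = table_points(1)[OF tab f(1)] and y = table_points(1)[OF tab f(2)]
  show 1: "flag b (confocal_coeffs a 0) x (cross3 x v)"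
    by (rule flag_velocity) (use x f(3,6) b in auto)
  have "y \<noteq> 0" "x \<noteq> 0" using x y by (auto simp: mink_def)
  moreover have "y \<bullet> cross3 x v = 0" using f(5)[symmetric] by (simp add: dot_cross_self)
  ultimately show 2: "flag b (confocal_coeffs a 0) y (cross3 x v)"
    using 1 y by (simp add: flag_def confocal_form_inner)
  have "(cross_eigenvalue (confocal_coeffs a 0) (cross3 x v) x)\<^sup>2
      = (cross_eigenvalue (confocal_coeffs a 0) (cross3 x v) y)\<^sup>2"
    using 1 2 on_cover_flag[of "confocal_coeffs a 0" b "cross3 x v"] unfolding flag_swap[of b]
    by (auto simp: on_cover_def) (smt (verit))
  hence "(confocal_form a 0 x v)\<^sup>2 = (confocal_form a 0 y w)\<^sup>2"
    using cross_eigenvalue_velocity[of x a v] cross_eigenvalue_velocity[of y a w] x y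
        by (simp add: f(5))
  thus "confocal_form a 0 y w = - confocal_form a 0 x v"
    using f(7,8) by (auto simp: power2_eq_iff)
qed

lemma cross_signs:
  "mink (signs * cross3 u w) z = z \<bullet> cross3 u w"
  by (simp add: mink_def inner_cyclic[of _ _ 0] signs_nth mult.commute)

lemma mink_cross_square:
  "mink (signs * cross3 u w) (signs * cross3 u w) = (mink u w)\<^sup>2 - mink u u * mink w w"
  by (simp add: mink_def signs_nth cross3_nth index_wrap) algebra

text \<open>
  A vector orthogonal to \<open>y\<close> and to the gradient \<open>A\<inverse> y\<close> is a multiple of their Lorentz cross
  product, whose square is minus the Gram determinant of the two.
\<close>

lemma lightlike_gradient:
  assumes "lightlike_tangent a y" "mink y y = 1" "confocal_form a 0 y y = 0"
  shows "mink (resolvent a 0 y) (resolvent a 0 y) = 0"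
proof -
  define g where "g = resolvent a 0 y"
  from assms(1) obtain t where t: "mink y t = 0" "mink g t = 0" "t \<noteq> 0" "mink t t = 0"
    by (auto simp: lightlike_tangent_def boundary_tangent_def tangent_space_def confocal_form_def
        g_def)
  have gy: "mink g y = 0" using assms(3) by (simp add: confocal_form_def g_def)
  show ?thesis
  proof (cases "cross3 y g = 0")
    case True
    hence "g = 0" using cross_zero_orthogonal[OF _ assms(2)] gy by (simp add: mink_commute)
    thus ?thesis by (simp add: g_def mink_def)
  next
    case False
    have "cross3 (cross3 y g) (signs * t) = - cross3 (signs * t) (cross3 y g)" by (rule cross_skew)
    also have "\<dots> = 0" using t(1,2) by (simp add: Cross3.Lagrange mink_inner inner_commute)
    finally obtain r where r: "signs * t = r *\<^sub>R cross3 y g"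
        using parallel_if_cross_zero False by blast
    have ss: "signs * (signs * u) = u" for u :: "real^3"
      by (simp add: vec_eq_iff mult.assoc[symmetric] signs_square)
    have "t = signs * (r *\<^sub>R cross3 y g)" unfolding r[symmetric] by (simp add: ss)
    hence tr: "t = r *\<^sub>R (signs * cross3 y g)" by (simp add: vec_eq_iff)
    hence "r \<noteq> 0" using t(3) by auto
    moreover have "r\<^sup>2 * ((mink y g)\<^sup>2 - mink y y * mink g g) = 0"
      using t(4) unfolding tr by (simp add: mink_linear mink_cross_square power2_eq_square)
    ultimately show ?thesis using gy assms(2) by (simp add: mink_commute g_def)
  qed
qed

lemma caustic_on_gradient:
  assumes "is_table a D"
  shows "(confocal_coeffs a 0 * y) \<bullet> (caustic_coeffs a \<alpha> \<beta> * (confocal_coeffs a 0 * y)) =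
    \<alpha> * confocal_form a 0 y y + \<beta> * mink (resolvent a 0 y) (resolvent a 0 y)"
  using table_entries(1)[OF assms, of 0] table_entries(1)[OF assms, of 1]
      table_entries(1)[OF assms, of 2]
  by (simp add: confocal_form_def mink_def resolvent_def inner_cyclic[of _ _ 0]
      signs_nth confocal_coeffs_def caustic_coeffs_def)
    (simp add: field_simps)

text \<open>
  The derivation property of a linear map of trace zero on the plane orthogonal to \<open>y\<close>.
\<close>

lemma trace_identity:
  assumes "y \<bullet> \<zeta> = 0" "y \<bullet> \<zeta>' = 0"
  shows "cross3 (cross3 y (b * \<zeta>)) \<zeta>' + cross3 \<zeta> (cross3 y (b * \<zeta>')) = 0"
proof -
  have "cross3 (cross3 y (b * \<zeta>)) \<zeta>' = - cross3 \<zeta>' (cross3 y (b * \<zeta>))" by (rule cross_skew)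
  moreover have "\<zeta>' \<bullet> (b * \<zeta>) = \<zeta> \<bullet> (b * \<zeta>')" by (simp add: inner_cyclic[of _ _ 0] mult_ac)
  ultimately show ?thesis using assms by (simp add: Cross3.Lagrange inner_commute)
qed

lemma cross_eigenvalues_opposite:
  assumes "flag b c y \<zeta>" "flag b c y \<zeta>'" "cross3 \<zeta> \<zeta>' \<noteq> 0"
  shows "cross_eigenvalue b y \<zeta>' = - cross_eigenvalue b y \<zeta>"
proof -
  have "(cross_eigenvalue b y \<zeta> + cross_eigenvalue b y \<zeta>') *\<^sub>R cross3 \<zeta> \<zeta>' = 0"
    using trace_identity[of y \<zeta> \<zeta>' b] assms(1,2)
    by (simp add: cross_eigenvector[OF assms(1)] cross_eigenvector[OF assms(2)]
        cross_mult_left cross_mult_right scaleR_add_left)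
      (simp add: flag_def)
  thus ?thesis using assms(3) by simp
qed

text \<open>
  In the product \<open>y \<eta>\<close> the weights \<open>b\<^sub>i c\<^sub>i = \<alpha> + \<beta> / a\<^sub>i\<close> meet the incidence relation of point and
  line, which removes \<open>\<alpha>\<close>.
\<close>

lemma cross_eigenvalue_reflection:
  assumes tab: "is_table a D" and fl: "flag (caustic_coeffs a \<alpha> \<beta>) (confocal_coeffs a 0) y (cross3
      y w)"
    and y: "mink y y = 1" "confocal_form a 0 y y = 0"
  shows "cross_eigenvalue (caustic_coeffs a \<alpha> \<beta>) y (cross3 y w) * confocal_form a 0 y w
      = \<beta> * (resolvent a 0 y \<bullet> cross3 y w)"
proof -
  have "y \<bullet> cross3 y w = 0" by (simp add: dot_cross_self)
  hence o: "y $ 0 * cross3 y w $ 0 + y $ 1 * cross3 y w $ 1 + y $ 2 * cross3 y w $ 2 = 0"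
    by (simp add: inner_cyclic[of _ _ 0])
  have "cross_eigenvalue (caustic_coeffs a \<alpha> \<beta>) y (cross3 y w) * confocal_form a 0 y w =
     \<alpha> * (y $ 0 * cross3 y w $ 0 + y $ 1 * cross3 y w $ 1 + y $ 2 * cross3 y w $ 2)
         + \<beta> * (resolvent a 0 y \<bullet> cross3 y w)"
    using cross_eigenvalue_mult[OF fl, of 0]
        unfolding cross_eigenvalue_velocity[OF y] coeffs_product[OF tab]
    by (simp add: inner_cyclic[of _ _ 0] resolvent_def algebra_simps)
  thus ?thesis using o by simp
qed

text \<open>
  The Lorentz cross product of \<open>y\<close> and \<open>A\<inverse> y\<close> is tangent to the boundary, and its product with \<open>n\<close>
  is the determinant of \<open>n\<close>, \<open>y\<close> and \<open>A\<inverse> y\<close>.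
\<close>

lemma normal_plane:
  assumes n: "n \<in> boundary_normal a y" and y: "confocal_form a 0 y y = 0"
  shows "resolvent a 0 y \<bullet> cross3 y n = 0"
proof -
  \<comment> \<open>the Lorentz cross product of \<open>y\<close> and the gradient of the boundary form\<close>
  define t where "t = signs * cross3 y (resolvent a 0 y)"
  have "mink y t = 0" by (simp add: t_def mink_commute[of y] cross_signs dot_cross_self)
  moreover have "confocal_form a 0 y t = 0"
    by (simp add: confocal_form_def t_def mink_commute[of "resolvent a 0 y"]
        cross_signs dot_cross_self)
  ultimately have "mink n t = 0" using n by (auto simp: boundary_normal_def boundary_tangent_def
      tangent_space_def)
  hence "n \<bullet> cross3 y (resolvent a 0 y) = 0" by (simp add: t_def mink_commute[of n] cross_signs)
  thus ?thesis by (simp add: inner_cyclic[of _ _ 0] cross3_nth index_wrap algebra_simps)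
qed

lemma reflects_facts:
  assumes tab: "is_table a D" and y: "mink y y = 1" "confocal_form a 0 y y = 0" "mink y w = 0"
    and r: "reflects a y w v'"
  shows "confocal_form a 0 y v' = - confocal_form a 0 y w" "mink y v' = 0"
    "resolvent a 0 y \<bullet> cross3 y v' = (if lightlike_tangent a y then - 1 else 1)
        * (resolvent a 0 y \<bullet> cross3 y w)"
proof -
  have "confocal_form a 0 y v' = - confocal_form a 0 y w \<and> mink y v' = 0 \<and>
    resolvent a 0 y \<bullet> cross3 y v' = (if lightlike_tangent a y then - 1 else 1)
        * (resolvent a 0 y \<bullet> cross3 y w)"
  proof (cases "lightlike_tangent a y")
    case True
    with r have "v' = - w" by (simp add: reflects_def)
    thus ?thesis using True y by (simp add: confocal_form_linear mink_linear)
  next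
    case False
    with r obtain t n where tn: "t \<in> boundary_tangent a y" "n \<in> boundary_normal a y" "w = t + n"
        "v' = t - n"
      by (auto simp: reflects_def)
    have "mink y t = 0" "confocal_form a 0 y t = 0" "mink y n = 0"
      using tn by (auto simp: boundary_tangent_def boundary_normal_def tangent_space_def)
    thus ?thesis using False normal_plane[OF tn(2) y(2)]
      by (simp add: tn(3,4) confocal_form_linear mink_linear cross_add_right
          Cross3.right_diff_distrib inner_add_right inner_diff_right)
  qed
  thus "confocal_form a 0 y v' = - confocal_form a 0 y w" "mink y v' = 0"
    "resolvent a 0 y \<bullet> cross3 y v' = (if lightlike_tangent a y then - 1 else 1)
        * (resolvent a 0 y \<bullet> cross3 y w)"
    by blast+
qed

text \<open>
  At an ordinary point \<open>\<eta>\<close> changes sign while \<open>y \<eta>\<close> does not, hence \<open>y\<close> changes sign. At a point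
  with light-like boundary tangent, the tangent line belongs to every dual conic of the confocal
  family. It is therefore the second line through the point; the step from it keeps the point and
  leads back to the incoming line.
\<close>

lemma poncelet_event:
  assumes tab: "is_table a D" and seg: "billiard_segment a D x v y w" and r: "reflects a y w v'"
    and b: "b = caustic_coeffs a \<alpha> \<beta>"
    and tangent: "cross3 x v \<bullet> (b * cross3 x v) = 0" "cross3 y v' \<bullet> (b * cross3 y v') = 0"
    and j: "confocal_form a 0 x v \<noteq> 0"
  shows "(poncelet_step b (confocal_coeffs a 0) ^^ reflection_count a y) (x, cross3 x v) (y,
      cross3 y v')"
    "lightlike_tangent a y \<Longrightarrow>
      poncelet_step b (confocal_coeffs a 0) (x, cross3 x v) (y, confocal_coeffs a 0 * y)"
    "confocal_form a 0 y v' = confocal_form a 0 x v"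
proof -
  define c where "c = confocal_coeffs a 0"
  define \<xi> where "\<xi> = cross3 x v"
  note f = billiard_segment_facts[OF tab seg]
  note jo = joachimsthal_segment[OF tab seg tangent(1), folded c_def \<xi>_def]
  have x: "mink x x = 1" "confocal_form a 0 x x = 0"
      and y: "mink y y = 1" "confocal_form a 0 y y = 0"
    using table_points(1)[OF tab] f(1,2) by auto
  note re = reflects_facts[OF tab y f(4) r]
  show jv: "confocal_form a 0 y v' = confocal_form a 0 x v" using re(1) jo(1) by simp
  have v': "v' \<noteq> 0" using jv j by (auto simp: confocal_form_linear confocal_form_def mink_def)
  have fy: "flag b c y (cross3 y v')"
    unfolding c_def by (rule flag_velocity[OF y re(2) v' tangent(2)])
  have yw: "cross3 y w = \<xi>" using f(5) by (simp add: \<xi>_def)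
  have roots: "cross_eigenvalue c \<xi> x = - confocal_form a 0 x v"
      "cross_eigenvalue c \<xi> y = confocal_form a 0 x v"
    using cross_eigenvalue_velocity[OF x, of v] cross_eigenvalue_velocity[OF y, of w] jo(1)
        by (simp_all add: c_def \<xi>_def f(5))
  have first: "flag b c x \<xi>" "flag b c y \<xi>" "cross_eigenvalue c \<xi> y = - cross_eigenvalue c \<xi> x"
    using jo(2,3) roots by simp_all
  have fw: "flag (caustic_coeffs a \<alpha> \<beta>) (confocal_coeffs a 0) y (cross3 y w)"
    using first(2) by (simp add: yw b c_def)
  have fv: "flag (caustic_coeffs a \<alpha> \<beta>) (confocal_coeffs a 0) y (cross3 y v')"
    using fy by (simp add: b c_def)
  have "cross_eigenvalue b y (cross3 y v') * confocal_form a 0 x v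
      = (if lightlike_tangent a y then 1 else - 1) * cross_eigenvalue b y \<xi> * confocal_form a 0 x v"
    using cross_eigenvalue_reflection[OF tab fw y] cross_eigenvalue_reflection[OF tab fv y] jo(1)
    unfolding re(3) jv by (auto simp: yw b split: if_splits)
  hence cmp: "cross_eigenvalue b y (cross3 y v')
      = (if lightlike_tangent a y then 1 else - 1) * cross_eigenvalue b y \<xi>"
    using j mult_right_cancel by blast
  have mid: "poncelet_step b c (x, \<xi>) (y, c * y)" "poncelet_step b c (y, c * y) (y, cross3 y v')"
    if light: "lightlike_tangent a y"
  proof -
    have "c * y \<noteq> 0"
    proof
      assume z: "c * y = 0"
      have "y $ i = 0" for i
        using arg_cong[OF z, of "\<lambda>u. u $ i"] table_entries(1)[OF tab, of i] signs_square(2)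
        by (auto simp: c_def confocal_coeffs_def)
      hence "y = 0" by (simp add: vec_eq_iff)
      with y(1) show False by (simp add: mink_def)
    qed
    hence fm: "flag b c y (c * y)"
      using caustic_on_gradient[OF tab, of y \<alpha> \<beta>] lightlike_gradient[OF light y] y fy
      by (simp add: flag_def b c_def)
    have cr: "cross3 \<xi> (c * y) = confocal_form a 0 x v *\<^sub>R y"
      using cross_velocity_gradient[OF y(2), of w] jo(1) by (simp add: yw c_def)
    hence "cross3 \<xi> (c * y) \<noteq> 0" using j y(1) by (auto simp: mink_def)
    from cross_eigenvalues_opposite[OF first(2) fm this] have rt: "cross_eigenvalue b y (c * y)
        = - cross_eigenvalue b y \<xi>" .
    show "poncelet_step b c (x, \<xi>) (y, c * y)"
      using first fm rt by (simp add: poncelet_step_def)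
    have "cross_eigenvalue c (c * y) y = 0" by (simp add: cross_eigenvalue_def)
    thus "poncelet_step b c (y, c * y) (y, cross3 y v')"
      using fm fy rt cmp light by (simp add: poncelet_step_def)
  qed
  show "lightlike_tangent a y \<Longrightarrow>
      poncelet_step b (confocal_coeffs a 0) (x, cross3 x v) (y, confocal_coeffs a 0 * y)"
    using mid(1) by (simp add: c_def \<xi>_def)
  show "(poncelet_step b (confocal_coeffs a 0) ^^ reflection_count a y) (x, cross3 x v) (y, cross3
      y v')"
  proof (cases "lightlike_tangent a y")
    case True
    have "(poncelet_step b c ^^ Suc (Suc 0)) (x, \<xi>) (y, cross3 y v')"
      using mid[OF True] by (auto intro!: relcomppI)
    thus ?thesis using True by (simp add: reflection_count_def c_def \<xi>_def numeral_2_eq_2)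
  next
    case False
    have "poncelet_step b c (x, \<xi>) (y, cross3 y v')"
      using first fy cmp False by (simp add: poncelet_step_def)
    thus ?thesis unfolding reflection_count_def c_def \<xi>_def using False by (auto intro!: relcomppI)
  qed
qed

section \<open>Sides of the tables\<close>

text \<open>
  Subtracting a multiple of one equation from the other leaves a sum of squares with positive
  coefficients, since \<open>a\<^sub>0\<close> is the smallest entry.
\<close>

lemma collared_gradient:
  assumes "collared a" "confocal_form a 0 y y = 0" "y \<noteq> 0"
  shows "mink (resolvent a 0 y) (resolvent a 0 y) \<noteq> 0"
proof
  assume n: "mink (resolvent a 0 y) (resolvent a 0 y) = 0"
  have a: "0 < a $ 0" "a $ 0 < a $ 1" "a $ 0 < a $ 2" using assms(1) by (auto simp: collared_def)
  define X where "X i = (y $ i)\<^sup>2 / a $ i" for i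
  have X: "X 0 = X 1 + X 2" "X 0 / a $ 0 = X 1 / a $ 1 + X 2 / a $ 2"
    using assms(2) n a by (simp_all add: X_def confocal_form_def mink_def resolvent_def
        power2_eq_square)
  have nn: "X 1 \<ge> 0" "X 2 \<ge> 0" using a by (simp_all add: X_def)
  have "X 1 * (1 / a $ 0 - 1 / a $ 1) + X 2 * (1 / a $ 0 - 1 / a $ 2) = 0"
    using X a by (simp add: algebra_simps add_divide_distrib)
  moreover have "1 / a $ 0 - 1 / a $ 1 > 0" "1 / a $ 0 - 1 / a $ 2 > 0"
      using a by (simp_all add: frac_less2)
  ultimately have "X 1 = 0" "X 2 = 0" using nn
    by (smt (verit) mult_nonneg_nonneg mult_pos_pos)+
  with X have "X 0 = 0" by simp
  hence "y $ 0 = 0" "y $ 1 = 0" "y $ 2 = 0" using a \<open>X 1 = 0\<close> \<open>X 2 = 0\<close> by (simp_all add: X_def)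
  hence "y $ i = 0" for i using index_012[of i] by auto
  with assms(3) show False by (simp add: vec_eq_iff)
qed

lemma collared_no_lightlike_tangent:
  assumes "collared a" "mink y y = 1" "confocal_form a 0 y y = 0"
  shows "\<not> lightlike_tangent a y"
proof -
  have "y \<noteq> 0" using assms(2) by (auto simp: mink_def)
  thus ?thesis using collared_gradient[OF assms(1,3)] lightlike_gradient[OF _ assms(2,3)] by blast
qed

text \<open>
  This is the reversed Cauchy-Schwarz inequality on one nappe of the solid cone \<open>\<langle>A\<inverse> x, x\<rangle> \<le> 0\<close>,
  which is convex.
\<close>

lemma collared_cone_same_side:
  assumes "collared a" "confocal_form a 0 x x = 0" "confocal_form a 0 y y = 0" "x $ 0 * y $ 0 \<ge> 0"
  shows "confocal_form a 0 x y \<le> 0"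
proof -
  have a: "0 < a $ 0" "0 < a $ 1" "0 < a $ 2" using assms(1) by (auto simp: collared_def)
  define s where "s u = u $ 1 * u $ 1 / a $ 1 + u $ 2 * u $ 2 / a $ 2" for u :: "real ^ 3"
  have x: "x $ 0 * x $ 0 / a $ 0 = s x" "y $ 0 * y $ 0 / a $ 0 = s y"
    using assms(2,3) by (simp_all add: s_def confocal_form_def mink_def resolvent_def)
  define t where "t = x $ 1 * y $ 1 / a $ 1 + x $ 2 * y $ 2 / a $ 2"
  have "s x * s y - t\<^sup>2 = (x $ 1 * y $ 2 - x $ 2 * y $ 1)\<^sup>2 / (a $ 1 * a $ 2)"
    using a by (simp add: s_def t_def field_simps power2_eq_square)
  hence "t\<^sup>2 \<le> s x * s y" using a by (smt (verit) divide_nonneg_pos mult_pos_pos zero_le_power2)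
  also have "\<dots> = (x $ 0 * y $ 0 / a $ 0)\<^sup>2" unfolding x[symmetric] by (simp add: power2_eq_square)
  finally have "t \<le> x $ 0 * y $ 0 / a $ 0"
    using assms(4) a by (meson abs_le_square_iff abs_of_nonneg abs_ge_self divide_nonneg_pos
        order.trans power2_le_imp_le)
  thus ?thesis by (simp add: t_def confocal_form_def mink_def resolvent_def)
qed

text \<open>
  The table is the exterior of the two nappes of the cone. With \<open>y = \<alpha> x + \<beta> v\<close> and \<open>\<beta> > 0\<close>, the
  bilinear value at \<open>x\<close> and \<open>y\<close> is \<open>\<beta> \<langle>A\<inverse> x, v\<rangle> > 0\<close>, which is impossible for two points of the same
  nappe; otherwise \<open>y = - x\<close>.
\<close>

lemma collared_alternates:
  assumes tab: "is_table a D" and col: "collared a" and seg: "billiard_segment a D x v y w"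
  shows "x $ 0 * y $ 0 < 0"
proof (rule ccontr)
  assume "\<not> ?thesis"
  hence nonneg: "x $ 0 * y $ 0 \<ge> 0" by simp
  note f = billiard_segment_facts[OF tab seg]
  note x = table_points(1)[OF tab f(1)] and y = table_points(1)[OF tab f(2)]
  from nonneg have le: "confocal_form a 0 x y \<le> 0"
    using collared_cone_same_side[OF col] x y by simp
  have x0: "x $ 0 \<noteq> 0"
  proof
    assume "x $ 0 = 0"
    hence "x $ 1 * x $ 1 / a $ 1 + x $ 2 * x $ 2 / a $ 2 = 0"
        using x by (simp add: confocal_form_def mink_def resolvent_def)
    moreover have "a $ 1 > 0" "a $ 2 > 0" using col by (auto simp: collared_def)
    ultimately have "x $ 1 = 0" "x $ 2 = 0"
      by (smt (verit) divide_nonneg_pos divide_pos_pos not_real_square_gt_zero zero_le_square)+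
    with \<open>x $ 0 = 0\<close> x show False by (simp add: mink_def)
  qed
  have ny: "y \<noteq> - x"
  proof
    assume "y = - x"
    hence "x $ 0 * y $ 0 = - (x $ 0)\<^sup>2" by (simp add: power2_eq_square)
    moreover have "(x $ 0)\<^sup>2 > 0" using x0 by simp
    ultimately show False using nonneg by linarith
  qed
  with f(9) obtain \<alpha> \<beta> where ab: "y = \<alpha> *\<^sub>R x + \<beta> *\<^sub>R v" "\<beta> > 0" by blast
  have "confocal_form a 0 x y = \<beta> * confocal_form a 0 x v"
      using x by (simp add: ab(1) confocal_form_linear)
  moreover have "confocal_form a 0 x v > 0" using f(7,10) ny by fastforce
  ultimately show False using le ab(2) by (simp add: mult_le_0_iff)
qed

lemma table_boundary_side:
  assumes "is_table a D" "x \<in> table_boundary a D"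
  shows "collared a \<or> x $ 2 > 0"
  using assms by (auto simp: is_table_def table_boundary_def transverse_domain_def)

text \<open>
  Otherwise the segment joins antipodal points, so the table is collared, and its line is the
  tangent to the boundary. Being tangent to two conics of the confocal family it would be tangent to
  the absolute, which no tangent to the boundary of a collared table is.
\<close>

lemma momentum_nonzero:
  assumes tab: "is_table a D" and seg: "billiard_segment a D x v y w" and "\<beta> \<noteq> 0"
    and tangent: "cross3 x v \<bullet> (caustic_coeffs a \<alpha> \<beta> * cross3 x v) = 0"
  shows "confocal_form a 0 x v \<noteq> 0"
proof
  assume j: "confocal_form a 0 x v = 0"
  note f = billiard_segment_facts[OF tab seg]
  note x = table_points(1)[OF tab f(1)]
  from f(10)[OF j] have "y = - x" .
  hence col: "collared a" using table_boundary_side[OF tab f(1)] table_boundary_side[OF tab f(2)]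
      by auto
  have x0: "x \<noteq> 0" using x by (auto simp: mink_def)
  have \<xi>0: "cross3 x v \<noteq> 0" using cross_zero_orthogonal[of x v] x f(3,6) by auto
  have "cross3 (cross3 x v) (confocal_coeffs a 0 * x) = 0"
    using cross_velocity_gradient[of a x v] x j by simp
  from parallel_if_cross_zero[OF this \<xi>0] obtain r where r: "confocal_coeffs a 0 * x
      = r *\<^sub>R cross3 x v" by blast
  have "\<alpha> * confocal_form a 0 x x + \<beta> * mink (resolvent a 0 x) (resolvent a 0 x) = 0"
    unfolding caustic_on_gradient[OF tab, symmetric] r
        using tangent by (simp add: inner_cyclic[of _ _ 0] algebra_simps)
      (simp add: mult.assoc flip: distrib_left)
  with \<open>\<beta> \<noteq> 0\<close> x collared_gradient[OF col _ x0] show False by simp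
qed

section \<open>Determinism\<close>

lemma velocity_determined:
  assumes "mink x x = 1" "mink x v = 0" "mink x v' = 0" "cross3 x v' = cross3 x v"
  shows "v' = v"
proof -
  have "cross3 x (v' - v) = 0" using assms(4) by (simp add: Cross3.right_diff_distrib)
  from cross_zero_orthogonal[OF this assms(1)] assms(2,3) show ?thesis by (simp add: mink_linear)
qed

lemma parallel_boundary_points:
  assumes tab: "is_table a D" and bd: "x \<in> table_boundary a D" "x' \<in> table_boundary a D"
    and r: "x' = r *\<^sub>R x" and side: "collared a \<Longrightarrow> x $ 0 * x' $ 0 > 0"
  shows "x' = x"
proof -
  have m: "mink x x = 1" "mink x' x' = 1" using table_points(1)[OF tab] bd by auto
  hence "r\<^sup>2 = 1" by (simp add: r mink_linear power2_eq_square)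
  hence "r = 1 \<or> r = - 1" by (simp add: power2_eq_1_iff)
  moreover have "r \<noteq> - 1"
  proof
    assume "r = - 1"
    hence "x' = - x" using r by simp
    hence "collared a" using table_boundary_side[OF tab bd(1)] table_boundary_side[OF tab bd(2)]
        by auto
    from side[OF this] \<open>x' = - x\<close> have "(x $ 0)\<^sup>2 < 0" by (simp add: power2_eq_square)
    thus False by (simp add: not_less)
  qed
  ultimately show ?thesis using r by simp
qed

lemma reflects_deterministic:
  assumes "reflects a y w v" "reflects a y w v'"
  shows "v = v'"
proof (cases "lightlike_tangent a y")
  case True
  thus ?thesis using assms by (simp add: reflects_def)
next
  case False
  obtain t n where 1: "t \<in> boundary_tangent a y" "n \<in> boundary_normal a y" "w = t + n" "v = t - n"
    using assms(1) False by (auto simp: reflects_def)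
  obtain t' n' where 2: "t' \<in> boundary_tangent a y" "n' \<in> boundary_normal a y" "w = t' + n'"
      "v' = t' - n'"
    using assms(2) False by (auto simp: reflects_def)
  have d: "t - t' = n' - n" using 1(3) 2(3) by (simp add: algebra_simps)
  have tt: "t - t' \<in> boundary_tangent a y" using 1(1) 2(1)
    by (simp add: boundary_tangent_def tangent_space_def mink_linear confocal_form_linear)
  hence "mink n (t - t') = 0" "mink n' (t - t') = 0"
      using 1(2) 2(2) by (auto simp: boundary_normal_def)
  hence "mink (n' - n) (t - t') = 0" by (simp add: mink_linear(2))
  hence "mink (t - t') (t - t') = 0" by (simp add: d)
  with tt False have "t = t'" by (auto simp: lightlike_tangent_def)
  with 1 2 show ?thesis by simp
qed

text \<open>
  Both endpoints are eigenvectors of \<open>\<zeta> \<mapsto> \<xi> \<times> (c \<zeta>)\<close> for the same nonzero eigenvalue. As the trace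
  is zero, this eigenvalue is simple, so they agree up to sign.
\<close>

lemma next_impact_deterministic:
  assumes tab: "is_table a D" and seg: "billiard_segment a D x v y w"
      "billiard_segment a D x v y' w'"
    and tangent: "cross3 x v \<bullet> (b * cross3 x v) = 0" and j: "confocal_form a 0 x v \<noteq> 0"
  shows "y' = y" "w' = w"
proof -
  define c \<xi> where "c = confocal_coeffs a 0" and "\<xi> = cross3 x v"
  note f = billiard_segment_facts[OF tab seg(1)] and f' = billiard_segment_facts[OF tab seg(2)]
  note jo = joachimsthal_segment[OF tab seg(1) tangent]
      and jo' = joachimsthal_segment[OF tab seg(2) tangent]
  note y = table_points(1)[OF tab f(2)] and y' = table_points(1)[OF tab f'(2)]
  have e: "cross3 \<xi> (c * y) = confocal_form a 0 x v *\<^sub>R y"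
      "cross3 \<xi> (c * y') = confocal_form a 0 x v *\<^sub>R y'"
    using cross_velocity_gradient[of a y w] cross_velocity_gradient[of a y' w']
        y y' jo(1) jo'(1) f(5) f'(5)
    by (simp_all add: c_def \<xi>_def)
  have "\<xi> \<bullet> y = 0" "\<xi> \<bullet> y' = 0" using jo(3) jo'(3) by (simp_all add: flag_def \<xi>_def inner_commute)
  from trace_identity[OF this, of c] have "(2 * confocal_form a 0 x v) *\<^sub>R cross3 y y' = 0"
    unfolding e by (simp add: cross_mult_left cross_mult_right scaleR_add_left[symmetric])
  hence "cross3 y y' = 0" using j by simp
  moreover have "y \<noteq> 0" using y by (auto simp: mink_def)
  ultimately obtain r where r: "y' = r *\<^sub>R y" using parallel_if_cross_zero by blast
  have "y $ 0 * y' $ 0 > 0" if "collared a"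
  proof -
    have "x $ 0 * y $ 0 < 0" "x $ 0 * y' $ 0 < 0"
        using collared_alternates[OF tab that] seg by blast+
    hence "(x $ 0 * y $ 0) * (x $ 0 * y' $ 0) > 0" by (rule mult_neg_neg)
    hence "(x $ 0)\<^sup>2 * (y $ 0 * y' $ 0) > 0" by (simp add: power2_eq_square mult_ac)
    thus ?thesis by (simp add: zero_less_mult_iff)
  qed
  from parallel_boundary_points[OF tab f(2) f'(2) r this] show yy: "y' = y" .
  show "w' = w" by (rule velocity_determined[of y]) (use y f f' yy in auto)
qed

section \<open>Caustics as dual conics\<close>

text \<open>
  The polar plane of a point \<open>z\<close> of the cone has the normal vector \<open>d\<close> obtained from \<open>z\<close> by the
  coefficients \<open>\<plusminus> 1 / (a\<^sub>i - \<mu>)\<close>, and the inverse coefficients give back \<open>z\<close>, so that the dual form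
  at \<open>d\<close> is the form at \<open>z\<close>.
\<close>

lemma tangent_to_cone_normal:
  assumes "\<And>i. a $ i \<noteq> \<mu>" and x: "mink x x = 1" and v: "mink x v = 0" "v \<noteq> 0"
    and t: "tangent_to_cone a \<mu> (span {x, v})"
  shows "cross3 x v \<bullet> (caustic_coeffs a 1 (- \<mu>) * cross3 x v) = 0"
proof -
  from t obtain z where z: "confocal_form a \<mu> z z = 0" "z \<noteq> 0"
      "span {x, v} = {y. confocal_form a \<mu> z y = 0}"
    unfolding tangent_to_cone_def confocal_cone_def by blast
  define d where "d = confocal_coeffs a \<mu> * z"
  have "x \<in> span {x, v}" "v \<in> span {x, v}" by (simp_all add: span_base)
  hence "x \<bullet> d = 0" "v \<bullet> d = 0" unfolding z(3) confocal_form_commute[of _ _ z]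
      by (simp_all add: confocal_form_inner d_def)
  hence "cross3 d (cross3 x v) = 0" by (simp add: Cross3.Lagrange inner_commute)
  moreover have "d \<noteq> 0"
  proof
    assume d0: "d = 0"
    have "z $ i = 0" for i using arg_cong[OF d0, of "\<lambda>u. u $ i"] assms(1)[of i]
        signs_square(2)[of i]
      by (simp add: d_def confocal_coeffs_def)
    with z(2) show False by (simp add: vec_eq_iff)
  qed
  ultimately obtain r where r: "cross3 x v = r *\<^sub>R d" using parallel_if_cross_zero by blast
  have "caustic_coeffs a 1 (- \<mu>) * d = z"
    using assms(1) signs_square(1) by (simp add: vec_eq_iff caustic_coeffs_def d_def
        confocal_coeffs_def field_simps)
  hence "caustic_coeffs a 1 (- \<mu>) * cross3 x v = r *\<^sub>R z" unfolding r
      by (simp add: vec_eq_iff algebra_simps)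
  moreover have "d \<bullet> z = 0" using z(1) by (simp add: confocal_form_inner d_def inner_commute)
  ultimately show ?thesis by (simp only: r inner_scaleR_left inner_scaleR_right mult_zero_right)
qed

text \<open>
  The tangent vector spans with \<open>x\<close> a degenerate plane, whose Lorentz normal is isotropic.
\<close>

lemma lightlike_normal:
  assumes "mink x v = 0" "mink v v = 0"
  shows "cross3 x v \<bullet> (caustic_coeffs a 0 1 * cross3 x v) = 0"
proof -
  have "caustic_coeffs a 0 1 = signs" by (simp add: vec_eq_iff caustic_coeffs_def)
  moreover have "cross3 x v \<bullet> (signs * cross3 x v) = mink (signs * cross3 x v) (signs * cross3 x v)"
    by (simp add: cross_signs mink_commute inner_commute)
  ultimately show ?thesis using assms by (simp add: mink_cross_square)
qed

lemma has_caustic_tangent: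
  assumes tab: "is_table a D" and tr: "billiard_trajectory a D p v" and ca: "has_caustic a p v \<nu>"
  defines "\<alpha> \<equiv> (if \<nu> = \<infinity> then 0 else 1)" and "\<beta> \<equiv> (if \<nu> = \<infinity> then 1 else - real_of_ereal \<nu>)"
  shows "\<alpha> * a $ i + \<beta> \<noteq> 0" "cross3 (p k) (v k) \<bullet> (caustic_coeffs a \<alpha> \<beta> * cross3 (p k) (v k)) = 0"
proof -
  obtain w where "billiard_segment a D (p k) (v k) (p (Suc k)) w"
      using tr by (auto simp: billiard_trajectory_def)
  note f = billiard_segment_facts[OF tab this]
  have x: "mink (p k) (p k) = 1" using table_points(1)[OF tab f(1)] by blast
  have "\<alpha> * a $ i + \<beta> \<noteq> 0 \<and> cross3 (p k) (v k) \<bullet> (caustic_coeffs a \<alpha> \<beta> * cross3 (p k) (v k)) = 0"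
    using ca unfolding has_caustic_def
  proof (elim disjE exE conjE)
    fix \<mu> assume \<mu>: "\<nu> = ereal \<mu>" "\<mu> \<notin> {a $ 0, a $ 1, a $ 2}"
        "\<forall>k. tangent_to_cone a \<mu> (span {p k, v k})"
    have ne: "a $ i \<noteq> \<mu>" for i using \<mu>(2) index_012[of i] by auto
    from tangent_to_cone_normal[OF this x f(3,6)] \<mu> ne[of i] show ?thesis by (simp add: \<alpha>_def \<beta>_def)
  next
    assume "\<nu> = \<infinity>" "\<forall>k. mink (v k) (v k) = 0"
    thus ?thesis using lightlike_normal[OF f(3), of a] by (simp add: \<alpha>_def \<beta>_def)
  qed
  thus "\<alpha> * a $ i + \<beta> \<noteq> 0" "cross3 (p k) (v k) \<bullet> (caustic_coeffs a \<alpha> \<beta> * cross3 (p k) (v k))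
      = 0" by blast+
qed

section \<open>Trajectories\<close>

lemma trajectory_sides:
  assumes tab: "is_table a D" and tr: "billiard_trajectory a D p v" and col: "collared a"
  shows "(- 1) ^ m * (p k $ 0 * p (k + m) $ 0) > 0"
proof (induction m)
  case 0
  obtain w where "billiard_segment a D (p k) (v k) (p (Suc k)) w"
      using tr by (auto simp: billiard_trajectory_def)
  from collared_alternates[OF tab col this] have "p k $ 0 \<noteq> 0" by auto
  thus ?case by (auto simp: zero_less_mult_iff linorder_neq_iff)
next
  case (Suc m)
  obtain w where "billiard_segment a D (p (k + m)) (v (k + m)) (p (Suc (k + m))) w"
    using tr by (auto simp: billiard_trajectory_def)
  from collared_alternates[OF tab col this] have "p (k + m) $ 0 * p (Suc (k + m)) $ 0 < 0" .
  hence "((- 1) ^ m * (p k $ 0 * p (k + m) $ 0)) * (p (k + m) $ 0 * p (Suc (k + m)) $ 0) < 0"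
    using Suc.IH by (simp add: mult_pos_neg)
  hence "(p (k + m) $ 0)\<^sup>2 * ((- 1) ^ Suc m * (p k $ 0 * p (k + Suc m) $ 0)) > 0"
    by (simp add: power2_eq_square mult_ac)
  thus ?case by (metis mult_nonneg_nonpos not_le zero_le_power2)
qed

lemma collared_return_even:
  assumes tab: "is_table a D" and tr: "billiard_trajectory a D p v" and col: "collared a"
  shows "p (k + m) = p k \<Longrightarrow> even m"
  using trajectory_sides[OF tab tr col, of m k] by (cases "even m") (auto simp: not_less)

lemma collared_reflection_count:
  assumes tab: "is_table a D" and tr: "billiard_trajectory a D p v" and col: "collared a"
  shows "(\<Sum>k=1..m. reflection_count a (p k)) = m"
proof -
  have "reflection_count a (p k) = 1" for k
  proof -
    obtain w where "billiard_segment a D (p k) (v k) (p (Suc k)) w"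
        using tr by (auto simp: billiard_trajectory_def)
    from table_points(1)[OF tab billiard_segment_facts(1)[OF tab this]]
    show ?thesis using collared_no_lightlike_tangent[OF col] by (simp add: reflection_count_def)
  qed
  thus ?thesis by simp
qed

text \<open>
  For \<open>\<beta> = 0\<close> the dual conic consists of the tangents to the boundary, and \<open>\<langle>A\<inverse> x, v\<rangle>\<close> vanishes.
  Such a segment exists only as a half of a closed space-like geodesic. The velocity is tangent to
  the boundary at its end and is therefore not changed by the reflection, and it is opposite to the
  initial one.
\<close>

lemma tangential_trajectory:
  assumes tab: "is_table a D" and seg: "billiard_segment a D x v y w" and r: "reflects a y w v'"
    and \<alpha>: "\<alpha> \<noteq> 0" and tangent: "cross3 x v \<bullet> (caustic_coeffs a \<alpha> 0 * cross3 x v) = 0"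
  shows "collared a" "y = - x" "v' = - v"
proof -
  note f = billiard_segment_facts[OF tab seg]
  note x = table_points(1)[OF tab f(1)] and y = table_points(1)[OF tab f(2)]
  define c where "c = confocal_coeffs a 0"
  note jo = joachimsthal_segment[OF tab seg tangent]
  have "on_cover c (caustic_coeffs a \<alpha> 0) (cross3 x v) (cross_eigenvalue c (cross3 x v) x)"
    by (rule on_cover_flag) (use jo(2) flag_swap in \<open>auto simp: c_def\<close>)
  hence "(confocal_form a 0 x v)\<^sup>2 = - (\<Sum>i\<in>UNIV. c $ (i + 1) * c $ (i + 2) * (cross3 x v $ i)\<^sup>2)"
    using cross_eigenvalue_velocity[of x a v] x by (simp add: on_cover_def c_def)
  also have "\<dots> = - (c $ 0 * c $ 1 * c $ 2 / \<alpha>) * (cross3 x v \<bullet> (caustic_coeffs a \<alpha> 0 * cross3 x v))"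
    using table_entries(1)[OF tab, of 0] table_entries(1)[OF tab, of 1]
        table_entries(1)[OF tab, of 2] \<alpha>
    by (simp add: sum_cyclic[of _ 0] inner_cyclic[of _ _ 0]
        index_wrap c_def confocal_coeffs_def caustic_coeffs_def signs_nth field_simps
        power2_eq_square)
  finally have j: "confocal_form a 0 x v = 0" using tangent by simp
  show yx: "y = - x" by (rule f(10)[OF j])
  show col: "collared a" using table_boundary_side[OF tab f(1)] table_boundary_side[OF tab f(2)]
      yx by auto
  have "- w = v"
    by (rule velocity_determined[of x]) (use x f(3,4,5) in \<open>simp_all add: yx mink_linear\<close>)
  hence wv: "w = - v" by (metis minus_minus)
  have nl: "\<not> lightlike_tangent a y" using collared_no_lightlike_tangent[OF col] y by blast
  then obtain t n where tn: "t \<in> boundary_tangent a y" "n \<in> boundary_normal a y" "w = t + n"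
      "v' = t - n"
    using r by (auto simp: reflects_def)
  have "confocal_form a 0 y w = 0" using jo(1) j by simp
  hence "w - t \<in> boundary_tangent a y" using tn(1) f(4)
    by (simp add: boundary_tangent_def tangent_space_def mink_linear confocal_form_linear)
  hence nt: "n \<in> boundary_tangent a y" using tn(3) by simp
  hence "mink n n = 0" using tn(2) by (auto simp: boundary_normal_def)
  with nt nl have "n = 0" by (auto simp: lightlike_tangent_def)
  thus "v' = - v" using tn(3,4) wv by simp
qed

context
  fixes a :: "real ^ 3" and D p v and \<alpha> \<beta> :: real
  assumes tab: "is_table a D" and tr: "billiard_trajectory a D p v"
    and \<beta>: "\<beta> \<noteq> 0"
    and tangent: "\<And>k. cross3 (p k) (v k) \<bullet> (caustic_coeffs a \<alpha> \<beta> * cross3 (p k) (v k)) = 0"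
begin

lemma trajectory_step:
  obtains w where "billiard_segment a D (p k) (v k) (p (Suc k)) w"
      "reflects a (p (Suc k)) w (v (Suc k))"
    "p k \<in> table_boundary a D" "mink (p k) (p k) = 1" "confocal_form a 0 (p k) (p k) = 0"
    "mink (p k) (v k) = 0" "confocal_form a 0 (p k) (v k) \<noteq> 0"
proof -
  obtain w where w: "billiard_segment a D (p k) (v k) (p (Suc k)) w"
      "reflects a (p (Suc k)) w (v (Suc k))"
    using tr by (auto simp: billiard_trajectory_def)
  note f = billiard_segment_facts[OF tab w(1)]
  show ?thesis using that[OF w f(1) _ _ f(3) momentum_nonzero[OF tab w(1) \<beta> tangent]]
    table_points(1)[OF tab f(1)] by blast
qed

lemma trajectory_event:
  shows "(poncelet_step (caustic_coeffs a \<alpha> \<beta>) (confocal_coeffs a 0) ^^ reflection_count a (p (Suc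
      k)))
      (p k, cross3 (p k) (v k)) (p (Suc k), cross3 (p (Suc k)) (v (Suc k)))"
    "lightlike_tangent a (p (Suc k)) \<Longrightarrow> poncelet_step (caustic_coeffs a \<alpha> \<beta>) (confocal_coeffs a 0)
      (p k, cross3 (p k) (v k)) (p (Suc k), confocal_coeffs a 0 * p (Suc k))"
    "confocal_form a 0 (p (Suc k)) (v (Suc k)) = confocal_form a 0 (p k) (v k)"
proof -
  obtain w where w: "billiard_segment a D (p k) (v k) (p (Suc k)) w"
      "reflects a (p (Suc k)) w (v (Suc k))"
     "confocal_form a 0 (p k) (v k) \<noteq> 0" using trajectory_step[of k] by metis
  note e = poncelet_event[OF tab w(1,2) refl tangent tangent w(3)]
  show "(poncelet_step (caustic_coeffs a \<alpha> \<beta>) (confocal_coeffs a 0) ^^ reflection_count a (p (Suc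
      k)))
      (p k, cross3 (p k) (v k)) (p (Suc k), cross3 (p (Suc k)) (v (Suc k)))"
    "lightlike_tangent a (p (Suc k)) \<Longrightarrow> poncelet_step (caustic_coeffs a \<alpha> \<beta>) (confocal_coeffs a 0)
      (p k, cross3 (p k) (v k)) (p (Suc k), confocal_coeffs a 0 * p (Suc k))"
    "confocal_form a 0 (p (Suc k)) (v (Suc k)) = confocal_form a 0 (p k) (v k)"
    using e by blast+
qed

lemma trajectory_chain:
  "(poncelet_step (caustic_coeffs a \<alpha> \<beta>) (confocal_coeffs a 0) ^^ (\<Sum>k=1..m. reflection_count a (p
      k)))
      (p 0, cross3 (p 0) (v 0)) (p m, cross3 (p m) (v m))"
proof (induction m)
  case (Suc m)
  have "(\<Sum>k=1..Suc m. reflection_count a (p k)) =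
      (\<Sum>k=1..m. reflection_count a (p k)) + reflection_count a (p (Suc m))" by simp
  thus ?case
    unfolding relpowp_add by (simp only: relpowp_add) (rule relcomppI, rule Suc.IH, rule
        trajectory_event(1))
qed simp

lemma trajectory_momentum: "confocal_form a 0 (p k) (v k) = confocal_form a 0 (p 0) (v 0)"
  by (induction k) (simp_all add: trajectory_event(3))

text \<open>
  Every number of Poncelet steps along the trajectory ends just after a reflection, or in the middle
  of a reflection that counts twice.
\<close>

lemma step_count_cases:
  "\<exists>m. n = (\<Sum>k=1..m. reflection_count a (p k)) \<or>
     n = Suc (\<Sum>k=1..m. reflection_count a (p k)) \<and> lightlike_tangent a (p (Suc m))"
proof (induction n)
  case 0
  show ?case by (intro exI[of _ 0]) simp
next
  case (Suc n)
  then obtain m where "n = (\<Sum>k=1..m. reflection_count a (p k)) \<or>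
     n = Suc (\<Sum>k=1..m. reflection_count a (p k)) \<and> lightlike_tangent a (p (Suc m))" by blast
  thus ?case
  proof (elim disjE conjE)
    assume n: "n = (\<Sum>k=1..m. reflection_count a (p k))"
    show ?thesis
    proof (cases "lightlike_tangent a (p (Suc m))")
      case True
      thus ?thesis using n by blast
    next
      case False
      hence "Suc n = (\<Sum>k=1..Suc m. reflection_count a (p k))"
          using n by (simp add: reflection_count_def)
      thus ?thesis by blast
    qed
  next
    assume "n = Suc (\<Sum>k=1..m. reflection_count a (p k))" "lightlike_tangent a (p (Suc m))"
    hence "Suc n = (\<Sum>k=1..Suc m. reflection_count a (p k))" by (simp add: reflection_count_def)
    thus ?thesis by blast
  qed
qed

text \<open>
  After \<open>n\<close> Poncelet steps the flag is projectively the initial one. It cannot be the intermediate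
  flag of a double reflection, since there the line is tangent to the boundary, which the initial
  line is not.
\<close>

lemma trajectory_closes_up:
  assumes reg: "regular_pair (caustic_coeffs a \<alpha> \<beta>) (confocal_coeffs a 0)" and n: "n > 0"
    and closed: "(poncelet_step (caustic_coeffs a \<alpha> \<beta>) (confocal_coeffs a 0) ^^ n) S S"
  shows "\<exists>m r s. n = (\<Sum>k=1..m. reflection_count a (p k)) \<and> p m = r *\<^sub>R p 0 \<and>
    cross3 (p m) (v m) = s *\<^sub>R cross3 (p 0) (v 0)"
proof -
  let ?step = "poncelet_step (caustic_coeffs a \<alpha> \<beta>) (confocal_coeffs a 0)"
  obtain m where "n = (\<Sum>k=1..m. reflection_count a (p k)) \<or>
     n = Suc (\<Sum>k=1..m. reflection_count a (p k)) \<and> lightlike_tangent a (p (Suc m))"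
    using step_count_cases by blast
  thus ?thesis
  proof (elim disjE conjE)
    assume N: "n = (\<Sum>k=1..m. reflection_count a (p k))"
    from poncelet_porism[OF reg n closed trajectory_chain[of m, folded N]] N show ?thesis by blast
  next
    assume N: "n = Suc (\<Sum>k=1..m. reflection_count a (p k))"
        and light: "lightlike_tangent a (p (Suc m))"
    have "(?step ^^ n) (p 0, cross3 (p 0) (v 0)) (p (Suc m), confocal_coeffs a 0 * p (Suc m))"
      unfolding N by (rule relpowp_Suc_I[OF trajectory_chain trajectory_event(2)[OF light]])
    from poncelet_porism[OF reg n closed this] obtain r s where rs: "p (Suc m) = r *\<^sub>R p 0"
      "confocal_coeffs a 0 * p (Suc m) = s *\<^sub>R cross3 (p 0) (v 0)" by blast
    obtain p0: "mink (p 0) (p 0) = 1" "confocal_form a 0 (p 0) (p 0) = 0"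
        "confocal_form a 0 (p 0) (v 0) \<noteq> 0"
      using trajectory_step[of 0] by metis
    obtain pm: "mink (p (Suc m)) (p (Suc m)) = 1" "confocal_form a 0 (p (Suc m)) (p (Suc m)) = 0"
      using trajectory_step[of "Suc m"] by metis
    have "p (Suc m) \<noteq> 0" using pm by (auto simp: mink_def)
    hence r: "r \<noteq> 0" using rs(1) by auto
    have "confocal_coeffs a 0 * p (Suc m) = r *\<^sub>R (confocal_coeffs a 0 * p 0)"
      by (simp add: rs(1) vec_eq_iff)
    hence e: "r *\<^sub>R (confocal_coeffs a 0 * p 0) = s *\<^sub>R cross3 (p 0) (v 0)" using rs(2) by simp
    have "cross3 (cross3 (p 0) (v 0)) (r *\<^sub>R (confocal_coeffs a 0 * p 0)) = 0"
      unfolding e by (simp add: cross_mult_right)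
    hence "(r * confocal_form a 0 (p 0) (v 0)) *\<^sub>R p 0 = 0"
      by (simp add: cross_mult_right cross_velocity_gradient[OF p0(2)])
    with r p0(1,3) have False by (auto simp: mink_def)
    thus ?thesis ..
  qed
qed

text \<open>
  The sides of the table decide the sign of the point, and \<open>\<langle>A\<inverse> x, v\<rangle>\<close>, which is linear in the
  velocity and conserved, decides its scale. From then on the motion repeats because it is
  deterministic.
\<close>

lemma trajectory_returns:
  assumes "p m = r *\<^sub>R p 0" "cross3 (p m) (v m) = s *\<^sub>R cross3 (p 0) (v 0)"
    and "collared a \<Longrightarrow> even m"
  shows "p (k + m) = p k \<and> v (k + m) = v k"
proof (induction k)
  case 0
  obtain p0: "p 0 \<in> table_boundary a D" "mink (p 0) (p 0) = 1" "confocal_form a 0 (p 0) (p 0) = 0"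
    "mink (p 0) (v 0) = 0" "confocal_form a 0 (p 0) (v 0) \<noteq> 0"
    using trajectory_step[of 0] by metis
  obtain pm: "p m \<in> table_boundary a D" "mink (p m) (v m) = 0" using trajectory_step[of m] by metis
  have "p m = p 0"
    by (rule parallel_boundary_points[OF tab p0(1) pm(1) assms(1)])
      (use trajectory_sides[OF tab tr, of m 0] assms(3) in simp)
  moreover have "s = 1"
  proof -
    have "confocal_form a 0 (p 0) (v m) = confocal_form a 0 (p 0) (v 0)"
      using trajectory_momentum[of m] \<open>p m = p 0\<close> by simp
    moreover have "cross3 (cross3 (p 0) (v m)) (confocal_coeffs a 0 * p 0) =
        s *\<^sub>R cross3 (cross3 (p 0) (v 0)) (confocal_coeffs a 0 * p 0)"
      using assms(2) by (simp add: \<open>p m = p 0\<close> cross_mult_left)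
    ultimately have "confocal_form a 0 (p 0) (v 0) *\<^sub>R p 0
        = (s * confocal_form a 0 (p 0) (v 0)) *\<^sub>R p 0"
      by (simp add: cross_velocity_gradient[OF p0(3)])
    with p0(2,5) show ?thesis by (auto simp: mink_def)
  qed
  moreover have "v m = v 0"
    by (rule velocity_determined[OF p0(2,4)]) (use pm(2) assms(2) \<open>p m = p 0\<close> \<open>s = 1\<close> in simp_all)
  ultimately show ?case by simp
next
  case (Suc k)
  obtain w where w: "billiard_segment a D (p k) (v k) (p (Suc k)) w"
      "reflects a (p (Suc k)) w (v (Suc k))"
    "confocal_form a 0 (p k) (v k) \<noteq> 0" using trajectory_step[of k] by metis
  obtain w' where w': "billiard_segment a D (p (k + m)) (v (k + m)) (p (Suc (k + m))) w'"
    "reflects a (p (Suc (k + m))) w' (v (Suc (k + m)))" using trajectory_step[of "k + m"] by metis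
  note w' = w'[unfolded conjunct1[OF Suc.IH] conjunct2[OF Suc.IH]]
  note nx = next_impact_deterministic[OF tab w(1) w'(1) tangent w(3)]
  have "v (Suc (k + m)) = v (Suc k)" using reflects_deterministic[OF w(2)] w'(2)
      unfolding nx by simp
  thus ?case using nx(1) by simp
qed

end

lemma tangential_trajectory_alternates:
  assumes tab: "is_table a D" and tr: "billiard_trajectory a D p v" and \<alpha>: "\<alpha> \<noteq> 0"
    and tangent: "\<And>k. cross3 (p k) (v k) \<bullet> (caustic_coeffs a \<alpha> 0 * cross3 (p k) (v k)) = 0"
  shows "collared a" "even m \<Longrightarrow> p (k + m) = p k \<and> v (k + m) = v k"
proof -
  have *: "collared a \<and> p (Suc k) = - p k \<and> v (Suc k) = - v k" for k
  proof -
    obtain w where "billiard_segment a D (p k) (v k) (p (Suc k)) w"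
        "reflects a (p (Suc k)) w (v (Suc k))"
      using tr by (auto simp: billiard_trajectory_def)
    from tangential_trajectory[OF tab this \<alpha> tangent] show ?thesis by blast
  qed
  thus "collared a" by blast
  have "p (k + 2 * i) = p k \<and> v (k + 2 * i) = v k" for i
    by (induction i) (simp_all add: *)
  thus "even m \<Longrightarrow> p (k + m) = p k \<and> v (k + m) = v k" by (elim evenE) blast
qed

theorem proposition5p3:
  fixes a :: "real ^ 3" and D :: "(real ^ 3) set"
    and p v q w :: "nat \<Rightarrow> real ^ 3" and n :: nat
  assumes "is_table a D"
    and "billiard_trajectory a D p v"
    and "billiard_trajectory a D q w"
    and "periodic_trajectory a n p v"
    and "same_caustic a p v q w"
  shows "periodic_trajectory a n q w"
proof -
  note tab = assms(1) and tp = assms(2) and tq = assms(3)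
  obtain \<nu> where \<nu>: "has_caustic a p v \<nu>" "has_caustic a q w \<nu>"
    using assms(5) by (auto simp: same_caustic_def)
  define \<alpha> \<beta> :: real where "\<alpha> = (if \<nu> = \<infinity> then 0 else 1)"
    and "\<beta> = (if \<nu> = \<infinity> then 1 else - real_of_ereal \<nu>)"
  note cp = has_caustic_tangent[OF tab tp \<nu>(1), folded \<alpha>_def \<beta>_def]
  note cq = has_caustic_tangent[OF tab tq \<nu>(2), folded \<alpha>_def \<beta>_def]
  obtain m where m: "m > 0" "\<And>k. p (k + m) = p k \<and> v (k + m) = v k"
    and n: "n = (\<Sum>k=1..m. reflection_count a (p k))"
    using assms(4) by (auto simp: periodic_trajectory_def)
  have "(\<Sum>k=1..m. 1) \<le> n" unfolding n by (rule sum_mono) (simp add: reflection_count_def)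
  hence n0: "n > 0" using m(1) by simp
  have col_even: "n = m \<and> even m" if "collared a"
    using collared_reflection_count[OF tab tp that] collared_return_even[OF tab tp that, of 0 m]
        m(2)[of 0] n by simp
  have "\<exists>m'. n = (\<Sum>k=1..m'. reflection_count a (q k)) \<and> (\<forall>k. q (k + m') = q k \<and> w (k + m') = w k)"
  proof (cases "\<beta> = 0")
    \<comment> \<open>the caustic is the boundary itself\<close>
    case True
    hence "\<alpha> \<noteq> 0" by (auto simp: \<alpha>_def \<beta>_def split: if_splits)
    note alt = tangential_trajectory_alternates[OF tab tq this cq(2)[unfolded True]]
    show ?thesis
      using collared_reflection_count[OF tab tq alt(1)] col_even[OF alt(1)] alt(2)[of n]
          by (intro exI[of _ n]) auto
  next
    case False
    have reg: "regular_pair (caustic_coeffs a \<alpha> \<beta>) (confocal_coeffs a 0)"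
      by (rule regular_coeffs[OF tab False cp(1)])
    have "(poncelet_step (caustic_coeffs a \<alpha> \<beta>) (confocal_coeffs a 0) ^^ n)
        (p 0, cross3 (p 0) (v 0)) (p 0, cross3 (p 0) (v 0))"
      using trajectory_chain[OF tab tp False cp(2), of m] m(2)[of 0] by (simp add: n)
    from trajectory_closes_up[OF tab tq False cq(2) reg n0 this]
    obtain m' r s where m': "n = (\<Sum>k=1..m'. reflection_count a (q k))" "q m' = r *\<^sub>R q 0"
      "cross3 (q m') (w m') = s *\<^sub>R cross3 (q 0) (w 0)" by blast
    have "even m'" if "collared a"
      using col_even[OF that] collared_reflection_count[OF tab tq that, of m'] m'(1) by simp
    from trajectory_returns[OF tab tq False cq(2) m'(2,3) this] m'(1) show ?thesis by blast
  qed
  then obtain m' where m': "n = (\<Sum>k=1..m'. reflection_count a (q k))"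
      "\<forall>k. q (k + m') = q k \<and> w (k + m') = w k"
    by blast
  moreover have "m' > 0" using m'(1) n0 by (cases m') auto
  ultimately show ?thesis unfolding periodic_trajectory_def by blast
qed

end
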